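(* Let $N\ge 1$ be an integer and let $p>0$ be a real number. For any set of parameters $(\boldsymbol u, M, \boldsymbol\sigma)$ with $\boldsymbol u=(u_1,\dots,u_N)$, $u_i\in\mathbb R_+$ for all $i$, $M=(M_{ij})$ a real $N\times N$ matrix with $M_{ij}=M_{ji}\ge 0$ for all $i,j$, and $\boldsymbol\sigma=(\sigma_1,\dots,\sigma_N)$ with $\sigma_i\ge 0$ for all $i$, there exists a unique $\boldsymbol x^*=(x_1^*,\dots,x_N^* )\in\mathbb R_+^N$ satisfying $$\sum_{j=1}^N M_{ij}(x_j^*-x_i^* )+\sigma_i\bigl(u_i-(x_i^* )^p\bigr)x_i^*=0,\qquad i=1,\dots,N,$$ and $\boldsymbol x^*$ is a locally exponentially stable equilibrium of the system of ordinary differential equations $$\dot x_i(t)=\sum_{j=1}^N M_{ij}(x_j(t)-x_i(t))+\sigma_i\bigl(u_i-x_i(t)^p\bigr)x_i(t),\qquad i=1,\dots,N.$$ The map $(\boldsymbol u,M,\boldsymbol\sigma)\mapsto\boldsymbol x^*$ is infinitely smooth. Moreover, any solution $\boldsymbol x(t)\in\mathbb R_+^N$ of this system converges, as $t\to\infty$, to the unique Nash equilibrium (namely $\boldsymbol x^*$) of the $N$-player game on $\mathbb R_+^N$ in which player $i$ chooses $x_i\in\mathbb R_+$ and seeks to minimize $$p_i(\boldsymbol x)=\frac12\sum_{j=1}^N M_{ij}(x_i-x_j)^2+\sigma_i\left(\frac{1}{p+2}x_i^{p+2}-\frac12u_ix_i^2\right).$$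
   Context: $\mathbb R_+=(0,\infty)$ denotes the positive reals. The exponent $p$ is fixed. A point $\boldsymbol x\in\mathbb R_+^N$ is a Nash equilibrium of the game if, for each $i$, $p_i(\boldsymbol x)=\min_{r_i\in\mathbb R_+}p_i(x_1,\dots,x_{i-1},r_i,x_{i+1},\dots,x_N)$, i.e. no player can improve (decrease) its own $p_i$ by a unilateral change of strategy while the strategies of the others are fixed. In the model, $x_i(t)$ is the opinion of agent $i$, $u_i$ its conviction parameter, $\sigma_i$ its stubbornness, and $M$ encodes the network couplings.
   Formalization: Added assumption: every connected component of the graph of M contains an agent with σ_i > 0 (smoothness is claimed on such parameters); without it uniqueness of x* always fails, e.g. for σ = 0 every consensus vector is an equilibrium. *)

theory Defs
  imports "HOL-Analysis.Analysis"
begin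

section \<open>Autonomous differential equations on a state space\<close>

definition solves_ode_on ::
    "('a::real_normed_vector \<Rightarrow> 'a) \<Rightarrow> 'a set \<Rightarrow> real set \<Rightarrow> (real \<Rightarrow> 'a) \<Rightarrow> bool" where
  "solves_ode_on f S I x \<longleftrightarrow>
     (\<forall>t\<in>I. x t \<in> S \<and> (x has_vector_derivative f (x t)) (at t within I))"

text \<open>
  Solutions through nearby initial values are required to exist for all positive times, so the
  notion is never vacuous. The estimate is imposed on every solution, for as long as it lives,
  so uniqueness of solutions is not presupposed.
\<close>
definition locally_exponentially_stable ::
    "('a::real_normed_vector \<Rightarrow> 'a) \<Rightarrow> 'a set \<Rightarrow> 'a \<Rightarrow> bool" where
  "locally_exponentially_stable f S z \<longleftrightarrow>
     z \<in> S \<and> f z = 0 \<and>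
     (\<exists>\<delta>>0. \<exists>C>0. \<exists>c>0. \<forall>x0\<in>S. norm (x0 - z) < \<delta> \<longrightarrow>
        (\<exists>x. x 0 = x0 \<and> solves_ode_on f S {0..} x) \<and>
        (\<forall>T>0. \<forall>x. x 0 = x0 \<and> solves_ode_on f S {0..<T} x \<longrightarrow>
           (\<forall>t\<in>{0..<T}. norm (x t - z) \<le> C * exp (- c * t) * norm (x0 - z))))"

section \<open>Infinitely smooth maps\<close>

text \<open>
  For open \<open>U\<close> and finite-dimensional domain this is the usual class of \<open>k\<close> times continuously
  differentiable maps: all directional derivatives of order up to \<open>k\<close> are continuous.
\<close>
primrec Ck_on ::
    "nat \<Rightarrow> 'a::euclidean_space set \<Rightarrow> ('a \<Rightarrow> 'b::euclidean_space) \<Rightarrow> bool" where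
  "Ck_on 0 U f \<longleftrightarrow> continuous_on U f"
| "Ck_on (Suc k) U f \<longleftrightarrow>
     (\<forall>x\<in>U. f differentiable (at x)) \<and>
     (\<forall>v. Ck_on k U (\<lambda>x. frechet_derivative f (at x) v))"

text \<open>
  The set \<open>D\<close> need not be open; as usual, smoothness on \<open>D\<close> means that near each point of \<open>D\<close>
  the map is the restriction of a smooth map defined on an open set of the ambient space.
\<close>
definition smooth_on ::
    "'a::euclidean_space set \<Rightarrow> ('a \<Rightarrow> 'b::euclidean_space) \<Rightarrow> bool" where
  "smooth_on D f \<longleftrightarrow>
     (\<forall>a\<in>D. \<exists>U g. open U \<and> a \<in> U \<and> (\<forall>k. Ck_on k U g) \<and> (\<forall>x\<in>D \<inter> U. g x = f x))"

section \<open>Games on a common strategy set\<close>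

definition nash_equilibrium ::
    "('n::finite \<Rightarrow> real^'n \<Rightarrow> real) \<Rightarrow> real set \<Rightarrow> real^'n \<Rightarrow> bool" where
  "nash_equilibrium cost R x \<longleftrightarrow>
     (\<forall>i. x $ i \<in> R \<and> (\<forall>r\<in>R. cost i x \<le> cost i (\<chi> k. if k = i then r else x $ k)))"

section \<open>The opinion model\<close>

type_synonym 'n opinion_params = "(real^'n) \<times> (real^'n^'n) \<times> (real^'n)"

definition pos_orthant :: "(real^'n) set" where
  "pos_orthant = {x. \<forall>i. 0 < x $ i}"

definition model_params :: "'n::finite opinion_params set" where
  "model_params = {(u, M, \<sigma>).
     (\<forall>i. 0 < u $ i) \<and> (\<forall>i j. M $ i $ j = M $ j $ i \<and> 0 \<le> M $ i $ j) \<and> (\<forall>i. 0 \<le> \<sigma> $ i)}"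

definition opinion_field :: "real \<Rightarrow> 'n::finite opinion_params \<Rightarrow> real^'n \<Rightarrow> real^'n" where
  "opinion_field p = (\<lambda>(u, M, \<sigma>) x.
     \<chi> i. (\<Sum>j\<in>UNIV. M $ i $ j * (x $ j - x $ i)) + \<sigma> $ i * (u $ i - x $ i powr p) * x $ i)"

definition steady_state :: "real \<Rightarrow> 'n::finite opinion_params \<Rightarrow> real^'n" where
  "steady_state p \<theta> = (THE x. x \<in> pos_orthant \<and> opinion_field p \<theta> x = 0)"

definition player_cost :: "real \<Rightarrow> 'n::finite opinion_params \<Rightarrow> 'n \<Rightarrow> real^'n \<Rightarrow> real" where
  "player_cost p = (\<lambda>(u, M, \<sigma>) i x.
     (1 / 2) * (\<Sum>j\<in>UNIV. M $ i $ j * (x $ i - x $ j)\<^sup>2) +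
     \<sigma> $ i * (1 / (p + 2) * x $ i powr (p + 2) - (1 / 2) * u $ i * (x $ i)\<^sup>2))"

text \<open>
  Every connected component of the coupling graph contains a stubborn agent (for instance,
  \<open>\<sigma>\<^sub>i > 0\<close> for all \<open>i\<close>, or \<open>M\<close> irreducible and \<open>\<sigma> \<noteq> 0\<close>). Nonnegativity of \<open>\<sigma>\<close> alone does not
  make the positive steady state unique: for \<open>\<sigma> = 0\<close> every consensus is one. The lemma below
  shows that uniqueness fails for \<^emph>\<open>every\<close> parameter violating this condition.
\<close>
definition anchored :: "'n::finite opinion_params \<Rightarrow> bool" where
  "anchored = (\<lambda>(u, M, \<sigma>). \<forall>i. \<exists>j. (i, j) \<in> {(k, l). 0 < M $ k $ l}\<^sup>* \<and> 0 < \<sigma> $ j)"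

lemma anchored_necessary:
  fixes \<theta> :: "'n::finite opinion_params"
  assumes "\<theta> \<in> model_params" and "\<not> anchored \<theta>"
  shows "\<not> (\<exists>!x. x \<in> pos_orthant \<and> opinion_field p \<theta> x = 0)"
proof
  assume ex: "\<exists>!x. x \<in> pos_orthant \<and> opinion_field p \<theta> x = 0"
  obtain u M \<sigma> where \<theta>: "\<theta> = (u, M, \<sigma>)" by (cases \<theta>)
  define E where "E = {(k, l). 0 < M $ k $ l}"
  from assms(2) obtain i where i: "\<And>j. (i, j) \<in> E\<^sup>* \<Longrightarrow> \<not> 0 < \<sigma> $ j"
    by (auto simp: anchored_def \<theta> E_def)
  define K where "K = {j. (i, j) \<in> E\<^sup>*}"
  have iK: "i \<in> K" by (simp add: K_def)
  have sym: "M $ k $ l = M $ l $ k" and nonneg: "0 \<le> M $ k $ l" and s: "0 \<le> \<sigma> $ k" for k l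
    using assms(1) by (auto simp: model_params_def \<theta>)
  have \<sigma>0: "\<sigma> $ k = 0" if "k \<in> K" for k
    using i[of k] s[of k] that by (auto simp: K_def)
  have M0: "M $ k $ l = 0" if "k \<in> K" "l \<notin> K" for k l
  proof (rule ccontr)
    assume "M $ k $ l \<noteq> 0"
    then have "(k, l) \<in> E" using nonneg[of k l] by (auto simp: E_def)
    then show False using that by (auto simp: K_def intro: rtrancl_into_rtrancl)
  qed
  obtain x where x: "x \<in> pos_orthant" "opinion_field p \<theta> x = 0" using ex by blast
  define y where "y = (\<chi> k. if k \<in> K then 2 * x $ k else x $ k)"
  have "y \<in> pos_orthant" using x(1) by (auto simp: pos_orthant_def y_def)
  moreover have "opinion_field p \<theta> y $ k = 0" for k
  proof -
    have fx: "(\<Sum>j\<in>UNIV. M $ k $ j * (x $ j - x $ k)) + \<sigma> $ k * (u $ k - x $ k powr p) * x $ k = 0"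
      using arg_cong[OF x(2), of "\<lambda>v. v $ k"] by (simp add: opinion_field_def \<theta>)
    show ?thesis
    proof (cases "k \<in> K")
      case True
      have "M $ k $ j * (y $ j - y $ k) = 2 * (M $ k $ j * (x $ j - x $ k))" for j
        using M0[OF True, of j] True by (cases "j \<in> K") (auto simp: y_def algebra_simps)
      then have "(\<Sum>j\<in>UNIV. M $ k $ j * (y $ j - y $ k)) =
          2 * (\<Sum>j\<in>UNIV. M $ k $ j * (x $ j - x $ k))"
        unfolding sum_distrib_left by (intro sum.cong refl)
      then show ?thesis using fx \<sigma>0[OF True] by (simp add: opinion_field_def \<theta>)
    next
      case False
      have "M $ k $ j * (y $ j - y $ k) = M $ k $ j * (x $ j - x $ k)" for j
        using M0[of j k] sym[of j k] False by (cases "j \<in> K") (auto simp: y_def)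
      then have "(\<Sum>j\<in>UNIV. M $ k $ j * (y $ j - y $ k)) =
          (\<Sum>j\<in>UNIV. M $ k $ j * (x $ j - x $ k))"
        by (intro sum.cong refl)
      moreover have "y $ k = x $ k" using False by (simp add: y_def)
      ultimately show ?thesis using fx by (simp add: opinion_field_def \<theta>)
    qed
  qed
  then have "opinion_field p \<theta> y = 0" by (simp add: vec_eq_iff)
  ultimately have "y = x" using ex x by blast
  then have "2 * x $ i = x $ i" using iK by (metis (mono_tags, lifting) y_def vec_lambda_beta)
  then show False using x(1) by (auto simp: pos_orthant_def dest: spec[of _ i])
qed

end

(*
  The Euclidean distance to the steady state z is a strict Lyapunov function on the whole orthant:
  in the ratios w = x / z, with A_ij = M_ij z_i z_j, symmetry of M and f z = 0 give
    <x - z, f x> = - 1/2 sum_ij A_ij (w_i - w_j)^2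
                   - sum_i sigma_i z_i^(p+2) (w_i - 1) w_i (w_i^p - 1),
  and anchoring makes this negative definite as long as w stays away from 0. This yields at once
  uniqueness, exponential decay, and invertibility of the Jacobian at z. Existence of z comes from
  Brouwer's theorem on a box of constants, and each player's cost has r times a nondecreasing
  function of r as its derivative, so zeros of f are the Nash equilibria. Smoothness follows from
  the inverse function theorem by bootstrapping the linear equation for the derivative of z, which
  Cramer's rule solves.
*)

theory Submission
  imports Defs
begin

text \<open>The dissipation rate degenerates near the boundary of the orthant:
  \<open>(w - 1) * (w * (w powr p - 1))\<close> vanishes at \<open>w = 0\<close> as well as at
  \<open>w = 1\<close>. Positivity of a solution alone gives no uniform rate, so convergence uses a
  second Lyapunov function, an entropy whose logarithm blows up at the boundary. Both come from one
  identity with a free multiplier \<open>\<psi>\<close>: \<open>w - 1\<close> gives the squared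
  distance, \<open>1 - 1 / w\<close> the entropy. Stability also demands solutions for all positive
  times, while the field is neither bounded nor Lipschitz on the whole orthant. Composing it with
  the projection onto a ball around the equilibrium repairs both; dissipation then keeps solutions
  in the ball, where nothing was changed. The parameter set is not open, and symmetry or
  nonnegativity of \<open>M\<close> may be lost off it. The smooth extension is therefore a branch
  of zeros for unrestricted parameters, along which positivity and a nonsingular Jacobian persist
  because they are open conditions. Uniqueness identifies this branch with the steady state on the
  parameter set.\<close>

section \<open>Calculus of smooth maps\<close>

declare Ck_on.simps(2) [simp del]

lemma Ck_on_cong:
  assumes "open U" "\<And>x. x \<in> U \<Longrightarrow> f x = g x" "Ck_on k U f"
  shows "Ck_on k U g"
  using assms(2,3)
proof (induction k arbitrary: f g)
  case 0
  then show ?case using continuous_on_cong[of U U f g] by simp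
next
  case (Suc k)
  have der: "(g has_derivative frechet_derivative f (at x)) (at x)" if "x \<in> U" for x
  proof (rule has_derivative_transform_within_open[OF _ assms(1) that])
    show "(f has_derivative frechet_derivative f (at x)) (at x)"
      using Suc.prems(2) that by (simp add: frechet_derivative_works Ck_on.simps(2))
  qed (use Suc.prems(1) in auto)
  then have eq: "frechet_derivative f (at x) = frechet_derivative g (at x)" if "x \<in> U" for x
    using frechet_derivative_at that by metis
  have "Ck_on k U (\<lambda>x. frechet_derivative g (at x) v)" for v
    by (rule Suc.IH[of "\<lambda>x. frechet_derivative f (at x) v"]) (use eq Suc.prems in \<open>auto simp: Ck_on.simps(2)\<close>)
  then show ?case using der by (auto simp: differentiable_def Ck_on.simps(2))
qed

text \<open>Any explicit derivative formula may replace \<open>frechet_derivative\<close>. The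
  closure rules below all follow this scheme: differentiate by the usual rule, then apply the
  induction hypothesis to each factor of the result.\<close>

lemma Ck_on_SucI:
  assumes "open U" and der: "\<And>x. x \<in> U \<Longrightarrow> (f has_derivative f' x) (at x)"
    and "\<And>v. Ck_on k U (\<lambda>x. f' x v)"
  shows "Ck_on (Suc k) U f"
proof -
  have "f' x = frechet_derivative f (at x)" if "x \<in> U" for x
    using der[OF that] by (rule frechet_derivative_at)
  then have "Ck_on k U (\<lambda>x. frechet_derivative f (at x) v)" for v
    by (intro Ck_on_cong[OF assms(1) _ assms(3)[of v]]) simp
  then show ?thesis using der by (auto simp: differentiable_def Ck_on.simps(2))
qed

lemma Ck_on_SucD:
  assumes "Ck_on (Suc k) U f"
  shows "\<And>x. x \<in> U \<Longrightarrow> (f has_derivative frechet_derivative f (at x)) (at x)"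
    and "\<And>v. Ck_on k U (\<lambda>x. frechet_derivative f (at x) v)"
  using assms by (simp_all add: frechet_derivative_works Ck_on.simps(2))

text \<open>The product, power and reciprocal rules leave undifferentiated functions in the
  derivative, whose order has to be lowered to match.\<close>

lemma Ck_on_Suc_imp: "Ck_on (Suc k) U f \<Longrightarrow> Ck_on k U f"
proof (induction k arbitrary: f)
  case 0
  then show ?case
    by (simp add: Ck_on.simps(2) differentiable_on_def differentiable_imp_continuous_on differentiable_at_withinI)
next
  case (Suc k)
  from Suc.prems show ?case
    unfolding Ck_on.simps(2)[of "Suc k"] Ck_on.simps(2)[of k U f] using Suc.IH by blast
qed

lemma Ck_on_const: "Ck_on k U (\<lambda>x. c)"
  by (induction k arbitrary: c) (simp_all add: Ck_on.simps(2))

lemma Ck_on_bounded_linear: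
  assumes "open U" "bounded_linear f"
  shows "Ck_on k U f"
proof (cases k)
  case 0
  then show ?thesis using assms linear_continuous_on by auto
next
  case (Suc l)
  then show ?thesis
    using bounded_linear_imp_has_derivative[OF assms(2)]
    by (auto intro!: Ck_on_SucI[where f' = "\<lambda>_. f"] simp: assms(1) Ck_on_const)
qed

lemma Ck_on_bounded_linear_compose:
  assumes "open U" "bounded_linear h" "Ck_on k U f"
  shows "Ck_on k U (\<lambda>x. h (f x))"
  using assms(3)
proof (induction k arbitrary: f)
  case 0
  then show ?case
    using bounded_linear.continuous_on[OF assms(2)] by simp
next
  case (Suc k)
  show ?case
    by (rule Ck_on_SucI[OF assms(1) bounded_linear.has_derivative[OF assms(2) Ck_on_SucD(1)[OF Suc.prems]]])
      (use Suc.IH[OF Ck_on_SucD(2)[OF Suc.prems]] in auto)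
qed

lemma Ck_on_add:
  assumes "open U" "Ck_on k U f" "Ck_on k U g"
  shows "Ck_on k U (\<lambda>x. f x + g x)"
  using assms(2,3)
proof (induction k arbitrary: f g)
  case 0
  then show ?case by (auto intro: continuous_intros)
next
  case (Suc k)
  show ?case
    by (rule Ck_on_SucI[OF assms(1) has_derivative_add[OF Suc.prems[THEN Ck_on_SucD(1)]]])
      (use Suc.IH[OF Suc.prems[THEN Ck_on_SucD(2)]] in auto)
qed

lemma Ck_on_mult:
  fixes f g :: "'a::euclidean_space \<Rightarrow> real"
  assumes "open U" "Ck_on k U f" "Ck_on k U g"
  shows "Ck_on k U (\<lambda>x. f x * g x)"
  using assms(2,3)
proof (induction k arbitrary: f g)
  case 0
  then show ?case by (auto intro: continuous_intros)
next
  case (Suc k)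
  show ?case
    by (rule Ck_on_SucI[OF assms(1) has_derivative_mult[OF Suc.prems[THEN Ck_on_SucD(1)]]])
      (auto intro!: Ck_on_add assms(1) Suc.IH Suc.prems[THEN Ck_on_SucD(2)] Suc.prems[THEN Ck_on_Suc_imp])
qed

lemma Ck_on_diff:
  fixes f g :: "'a::euclidean_space \<Rightarrow> real"
  assumes "open U" "Ck_on k U f" "Ck_on k U g"
  shows "Ck_on k U (\<lambda>x. f x - g x)"
  using Ck_on_add[OF assms(1,2) Ck_on_mult[OF assms(1) Ck_on_const[of _ _ "-1"] assms(3)]] by simp

lemma Ck_on_sum:
  assumes "open U" "\<And>i. i \<in> I \<Longrightarrow> Ck_on k U (f i)"
  shows "Ck_on k U (\<lambda>x. \<Sum>i\<in>I. f i x)"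
  using assms(2) by (induction I rule: infinite_finite_induct) (auto intro: Ck_on_const Ck_on_add assms(1))

lemma Ck_on_prod:
  fixes f :: "'i \<Rightarrow> 'a::euclidean_space \<Rightarrow> real"
  assumes "open U" "\<And>i. i \<in> I \<Longrightarrow> Ck_on k U (f i)"
  shows "Ck_on k U (\<lambda>x. \<Prod>i\<in>I. f i x)"
  using assms(2) by (induction I rule: infinite_finite_induct) (auto intro: Ck_on_const Ck_on_mult assms(1))

text \<open>Differentiation lowers the exponent to \<open>q - 1\<close>, so the induction runs over
  all real exponents at once.\<close>

lemma Ck_on_powr:
  fixes f :: "'a::euclidean_space \<Rightarrow> real"
  assumes "open U" "\<And>x. x \<in> U \<Longrightarrow> 0 < f x" "Ck_on k U f"
  shows "Ck_on k U (\<lambda>x. f x powr q)"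
  using assms(3)
proof (induction k arbitrary: q)
  case 0
  then show ?case using assms(2) by (force intro: continuous_intros)
next
  case (Suc k)
  have "((\<lambda>x. f x powr q) has_derivative
      (\<lambda>v. q * (f x powr (q - 1) * frechet_derivative f (at x) v))) (at x)" if "x \<in> U" for x
    using Ck_on_SucD(1)[OF Suc.prems that] assms(2)[OF that]
    by (auto intro!: derivative_eq_intros simp: powr_diff fun_eq_iff)
  then show ?case
    by (rule Ck_on_SucI[OF assms(1)])
      (auto intro!: Ck_on_mult assms(1) Ck_on_const Suc.IH Suc.prems[THEN Ck_on_SucD(2)] Suc.prems[THEN Ck_on_Suc_imp])
qed

lemma Ck_on_inverse:
  fixes f :: "'a::euclidean_space \<Rightarrow> real"
  assumes "open U" "\<And>x. x \<in> U \<Longrightarrow> f x \<noteq> 0" "Ck_on k U f"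
  shows "Ck_on k U (\<lambda>x. inverse (f x))"
  using assms(3)
proof (induction k)
  case 0
  then show ?case using assms(2) by (auto intro: continuous_intros)
next
  case (Suc k)
  have "((\<lambda>x. inverse (f x)) has_derivative
      (\<lambda>v. (-1) * (frechet_derivative f (at x) v * (inverse (f x) * inverse (f x))))) (at x)"
    if "x \<in> U" for x
    using Ck_on_SucD(1)[OF Suc.prems that] assms(2)[OF that]
    by (auto intro!: derivative_eq_intros simp: fun_eq_iff)
  then show ?case
    by (rule Ck_on_SucI[OF assms(1)])
      (assumption, intro Ck_on_mult assms(1) Ck_on_const Suc.IH Suc.prems[THEN Ck_on_SucD(2)] Suc.prems[THEN Ck_on_Suc_imp])
qed

lemma Ck_on_vec_nth:
  assumes "open U" "Ck_on k U f"
  shows "Ck_on k U (\<lambda>x. f x $ i)"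
  using Ck_on_bounded_linear_compose[OF assms(1) bounded_linear_vec_nth assms(2)] .

lemma Ck_on_vec_lambda:
  fixes f :: "'a::euclidean_space \<Rightarrow> real^'n"
  assumes "open U" "\<And>i. Ck_on k U (\<lambda>x. f x $ i)"
  shows "Ck_on k U f"
proof -
  have "f = (\<lambda>x. \<Sum>i\<in>UNIV. f x $ i *\<^sub>R axis i 1)"
    by (simp add: fun_eq_iff vec_eq_iff axis_def sum.delta if_distrib cong: if_cong)
  moreover have "Ck_on k U (\<lambda>x. \<Sum>i\<in>UNIV. f x $ i *\<^sub>R axis i (1::real))"
    by (intro Ck_on_sum assms(1) Ck_on_bounded_linear_compose[OF assms(1) bounded_linear_scaleR_left assms(2)])
  ultimately show ?thesis by simp
qed

lemma Ck_on_det: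
  fixes A :: "'a::euclidean_space \<Rightarrow> real^'n^'n"
  assumes "open U" "\<And>i j. Ck_on k U (\<lambda>x. A x $ i $ j)"
  shows "Ck_on k U (\<lambda>x. det (A x))"
  unfolding det_def by (intro Ck_on_sum Ck_on_mult Ck_on_prod Ck_on_const assms)

text \<open>No regularity of \<open>w\<close> is assumed: its components are quotients of
  determinants in the data and inherit the order of the data.\<close>

lemma Ck_on_linear_solve:
  fixes A :: "'a::euclidean_space \<Rightarrow> real^'n^'n"
  assumes "open U" "\<And>i j. Ck_on k U (\<lambda>x. A x $ i $ j)" "\<And>i. Ck_on k U (\<lambda>x. b x $ i)"
    and nz: "\<And>x. x \<in> U \<Longrightarrow> det (A x) \<noteq> 0"
    and sol: "\<And>x. x \<in> U \<Longrightarrow> A x *v w x = b x"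
  shows "Ck_on k U w"
proof (rule Ck_on_vec_lambda[OF assms(1)])
  fix l
  have "w x $ l = det (\<chi> i j. if j = l then b x $ i else A x $ i $ j) * inverse (det (A x))"
    if "x \<in> U" for x
    using sol[OF that] unfolding cramer[OF nz[OF that]] by (simp add: divide_inverse)
  moreover have "Ck_on k U (\<lambda>x. (\<chi> i j. if j = l then b x $ i else A x $ i $ j) $ i $ j)" for i j
    using assms(2,3) by (cases "j = l") auto
  then have det: "Ck_on k U (\<lambda>x. det (\<chi> i j. if j = l then b x $ i else A x $ i $ j) * inverse (det (A x)))"
    by (intro Ck_on_mult Ck_on_inverse Ck_on_det assms nz)
  ultimately show "Ck_on k U (\<lambda>x. w x $ l)"
    by (intro Ck_on_cong[OF assms(1) _ det]) simp
qed

section \<open>Global solutions for bounded Lipschitz fields\<close>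

lemma integral_has_vector_derivative_atLeast:
  fixes g :: "real \<Rightarrow> 'a::banach"
  assumes "continuous_on {0..} g" "0 \<le> t"
  shows "((\<lambda>u. integral {0..u} g) has_vector_derivative g t) (at t within {0..})"
proof -
  have "((\<lambda>u. integral {0..u} g) has_vector_derivative g t) (at t within {0..t+1})"
    by (rule integral_has_vector_derivative) (use assms in \<open>auto intro: continuous_on_subset\<close>)
  moreover have "at t within {0..t+1} = at t within {0..}"
    by (rule at_within_nhd[of _ "{..<t+1}"]) auto
  ultimately show ?thesis by simp
qed

text \<open>Picard iteration on the whole half-line at once. In the rescaled unknown
  \<open>z s = exp (- K * s) *\<^sub>R x s\<close> the integral operator contracts the supremum norm
  by the factor \<open>L / K\<close>; boundedness of \<open>F\<close> keeps the iterates
  bounded.\<close>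

lemma bounded_lipschitz_ode_solution:
  fixes F :: "'a::euclidean_space \<Rightarrow> 'a"
  assumes lip: "L-lipschitz_on UNIV F" and bdd: "bounded (range F)"
  obtains x where "x 0 = x0" "\<And>t. 0 \<le> t \<Longrightarrow> (x has_vector_derivative F (x t)) (at t within {0..})"
proof -
  \<comment> \<open>Any positive weight exceeding \<open>L\<close> would make \<open>L / K\<close>
    less than 1.\<close>
  define K where "K = L + 1"
  have L: "0 \<le> L" using lip by (rule lipschitz_on_nonneg)
  then have K: "0 < K" "L < K" by (auto simp: K_def)
  obtain B where B: "\<And>y. norm (F y) \<le> B" using bdd by (auto simp: bounded_iff)
  then have B0: "0 \<le> B" using norm_ge_zero order_trans by blast
  have contF: "continuous_on UNIV F" using lip by (rule lipschitz_on_continuous_on)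
  define G where "G z s = F (exp (K * s) *\<^sub>R apply_bcontfun z s)" for z s
  define S where "S z t = exp (- K * t) *\<^sub>R (x0 + integral {0..t} (G z))" for z t
  have contG: "continuous_on X (G z)" for X z
    unfolding G_def by (rule continuous_on_compose2[OF contF]) (auto intro!: continuous_intros)
  have intG: "G z integrable_on {0..t}" for z t
    by (intro integrable_continuous_real contG)
  have derG: "((\<lambda>t. integral {0..t} (G z)) has_vector_derivative G z t) (at t within {0..})"
    if "0 \<le> t" for z t
    using contG that by (rule integral_has_vector_derivative_atLeast)
  have "continuous_on {0..} (S z)" for z
    unfolding S_def
    by (intro continuous_intros continuous_on_vector_derivative[OF derG]) auto
  \<comment> \<open>Bounded continuous functions live on all of the real line here, so the iterate
    is frozen at its initial value for negative times.\<close>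
  then have contS: "continuous_on UNIV (\<lambda>t. S z (max t 0))" for z
    by (rule continuous_on_compose2) (auto intro!: continuous_intros)
  have bndS: "norm (S z t) \<le> norm x0 + B / K" if t: "0 \<le> t" for z t
  proof -
    have "norm (integral {0..t} (G z)) \<le> B * t"
      using has_integral_bound_real[OF B0 finite.emptyI integrable_integral[OF intG[of z t]]] B t
      by (simp add: G_def)
    then have "norm (S z t) \<le> exp (- K * t) * (norm x0 + B * t)"
      unfolding S_def by (auto intro!: norm_triangle_le)
    also have "\<dots> = exp (- K * t) * norm x0 + exp (- K * t) * (B / K * (K * t))"
      using K by (simp add: algebra_simps)
    \<comment> \<open>The linear growth of the integral is absorbed by
      \<open>K * t \<le> exp (K * t)\<close>.\<close>
    also have "\<dots> \<le> 1 * norm x0 + exp (- K * t) * (B / K * exp (K * t))"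
      using K t B0 order_trans[OF _ exp_ge_add_one_self[of "K * t"]]
      by (intro add_mono mult_right_mono mult_left_mono) auto
    also have "\<dots> = norm x0 + B / K"
      by (simp add: exp_minus)
    finally show ?thesis .
  qed
  have "(\<lambda>t. S z (max t 0)) \<in> bcontfun" for z
    unfolding bcontfun_def bounded_iff using contS bndS[OF max.cobounded2] by blast
  then have app: "apply_bcontfun (Bcontfun (\<lambda>t. S z (max t 0))) t = S z (max t 0)" for z t
    by (simp add: Bcontfun_inverse)
  have contr: "dist (S z t) (S z' t) \<le> L / K * dist z z'" if t: "0 \<le> t" for z z' t
  proof -
    have "norm (G z s - G z' s) \<le> L * dist z z' * exp (K * s)" for s
    proof -
      have "norm (G z s - G z' s) \<le> L * dist (exp (K * s) *\<^sub>R apply_bcontfun z s) (exp (K * s) *\<^sub>R apply_bcontfun z' s)"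
        unfolding G_def dist_norm[symmetric] by (rule lipschitz_onD[OF lip]) auto
      also have "\<dots> = L * (exp (K * s) * dist (apply_bcontfun z s) (apply_bcontfun z' s))"
        by (simp add: dist_norm flip: scaleR_diff_right)
      also have "\<dots> \<le> L * (exp (K * s) * dist z z')"
        by (intro mult_left_mono L dist_bounded) auto
      finally show ?thesis by (simp add: mult_ac)
    qed
    moreover have "((\<lambda>s. L * dist z z' * exp (K * s)) has_integral
        (L * dist z z' * exp (K * t) / K - L * dist z z' * exp (K * 0) / K)) {0..t}"
      using t K by (intro fundamental_theorem_of_calculus)
        (auto intro!: derivative_eq_intros simp: has_real_derivative_iff_has_vector_derivative[symmetric])
    ultimately have "norm (integral {0..t} (\<lambda>s. G z s - G z' s))
        \<le> L * dist z z' * exp (K * t) / K - L * dist z z' * exp (K * 0) / K"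
      by (intro integral_norm_bound_integral[THEN order_trans] integrable_diff intG)
        (auto simp: has_integral_iff)
    also have "\<dots> \<le> L / K * dist z z' * exp (K * t)"
      using L K by (simp add: field_simps)
    finally have "exp (- K * t) * norm (integral {0..t} (\<lambda>s. G z s - G z' s))
        \<le> exp (- K * t) * (L / K * dist z z' * exp (K * t))"
      by (intro mult_left_mono) auto
    moreover have "S z t - S z' t = exp (- K * t) *\<^sub>R integral {0..t} (\<lambda>s. G z s - G z' s)"
      unfolding S_def by (simp add: integral_diff intG scaleR_diff_right[symmetric] del: scaleR_diff_right)
    ultimately show ?thesis by (simp add: dist_norm exp_minus field_simps)
  qed
  have "\<exists>!z. Bcontfun (\<lambda>t. S z (max t 0)) = z"
  proof (rule banach_fix_type[of "L / K"], safe)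
    show "dist (Bcontfun (\<lambda>t. S z (max t 0))) (Bcontfun (\<lambda>t. S z' (max t 0))) \<le> L / K * dist z z'" for z z'
      by (rule dist_bound) (unfold app, rule contr, simp)
  qed (use L K in auto)
  then obtain z where z: "Bcontfun (\<lambda>t. S z (max t 0)) = z" by blast
  define x where "x t = x0 + integral {0..t} (G z)" for t
  have Gx: "G z t = F (x t)" if "0 \<le> t" for t
    using app[of z t, unfolded z] that by (simp add: G_def S_def x_def exp_minus)
  show thesis
  proof (rule that)
    show "x 0 = x0" by (simp add: x_def)
    show "(x has_vector_derivative F (x t)) (at t within {0..})" if "0 \<le> t" for t
      unfolding Gx[OF that, symmetric] unfolding x_def
      using has_vector_derivative_add[OF has_vector_derivative_const derG[OF that]] by simp
  qed
qed

section \<open>Dissipation of the opinion model\<close>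

text \<open>Both cases combine \<open>ln y \<le> y - 1\<close> with
  \<open>1 + y \<le> exp y\<close>. For \<open>w \<ge> 1\<close> this gives the factor
  \<open>p\<close>, for \<open>w < 1\<close> only \<open>p * w powr (p + 1)\<close>. The loss is
  genuine: at \<open>w = 0\<close> the right-hand side vanishes and the square does not, hence the
  lower bound \<open>\<eta>\<close>.\<close>

lemma mult_powr_minus_one_ge:
  fixes w p \<eta> :: real
  assumes "0 < p" "0 < \<eta>" "\<eta> \<le> 1" "\<eta> \<le> w"
  shows "p * \<eta> powr (p + 1) * (w - 1)\<^sup>2 \<le> (w - 1) * (w * (w powr p - 1))"
proof (cases "1 \<le> w")
  case True
  have "1 - 1 / w \<le> ln w"
    using ln_le_minus_one[of "1 / w"] True by (simp add: ln_div)
  then have "p * (1 - 1 / w) \<le> p * ln w"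
    using assms(1) by (intro mult_left_mono) auto
  also have "\<dots> \<le> w powr p - 1"
    using True exp_ge_add_one_self[of "p * ln w"] by (simp add: powr_def del: exp_ge_add_one_self)
  finally have "w * (p * (1 - 1 / w)) \<le> w * (w powr p - 1)"
    using True by (intro mult_left_mono) auto
  moreover have "w * (p * (1 - 1 / w)) = p * (w - 1)"
    using True by (simp add: field_simps)
  ultimately have "p * (w - 1) \<le> w * (w powr p - 1)" by simp
  then have "(w - 1) * (p * (w - 1)) \<le> (w - 1) * (w * (w powr p - 1))"
    using True by (intro mult_left_mono) auto
  moreover have "\<eta> powr (p + 1) \<le> 1"
    using assms by (simp add: powr_le1)
  then have "p * (w - 1)\<^sup>2 * \<eta> powr (p + 1) \<le> p * (w - 1)\<^sup>2"
    using assms(1) by (intro mult_left_le) auto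
  ultimately show ?thesis by (simp add: power2_eq_square algebra_simps)
next
  case False
  have w: "0 < w" using assms by simp
  have "p * (1 - w) \<le> p * (- ln w)"
    using assms(1) ln_le_minus_one[OF w] by (intro mult_left_mono) auto
  also have "\<dots> \<le> w powr (- p) - 1"
    using w exp_ge_add_one_self[of "- p * ln w"] by (simp add: powr_def del: exp_ge_add_one_self)
  finally have "w * w powr p * (p * (1 - w)) \<le> w * w powr p * (w powr (- p) - 1)"
    using w by (intro mult_left_mono) auto
  also have "\<dots> = w * (1 - w powr p)"
    using w by (simp add: algebra_simps powr_minus)
  finally have "p * w powr (p + 1) * (1 - w) \<le> w * (1 - w powr p)"
    using w by (simp add: powr_add mult_ac)
  moreover have "p * \<eta> powr (p + 1) * (1 - w) \<le> p * w powr (p + 1) * (1 - w)"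
    using assms False by (intro mult_right_mono mult_left_mono powr_mono2) auto
  ultimately have "(1 - w) * (p * \<eta> powr (p + 1) * (1 - w)) \<le> (1 - w) * (w * (1 - w powr p))"
    using False by (intro mult_left_mono) auto
  then show ?thesis by (simp add: power2_eq_square algebra_simps)
qed

text \<open>Summation by parts on a weighted graph: average the double sum with its copy in which
  \<open>i\<close> and \<open>j\<close> are exchanged.\<close>

lemma sum_symmetrize:
  fixes A :: "'n::finite \<Rightarrow> 'n \<Rightarrow> real"
  assumes "\<And>i j. A i j = A j i"
  shows "(\<Sum>i\<in>UNIV. \<psi> i * (\<Sum>j\<in>UNIV. A i j * (w j - w i)))
    = - (1 / 2) * (\<Sum>i\<in>UNIV. \<Sum>j\<in>UNIV. A i j * ((\<psi> i - \<psi> j) * (w i - w j)))"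
proof -
  have "(\<Sum>i\<in>UNIV. \<psi> i * (\<Sum>j\<in>UNIV. A i j * (w j - w i)))
      = (\<Sum>i\<in>UNIV. \<Sum>j\<in>UNIV. A i j * (\<psi> i * (w j - w i)))" (is "?S = _")
    by (simp add: sum_distrib_left mult_ac)
  moreover have "\<dots> = (\<Sum>i\<in>UNIV. \<Sum>j\<in>UNIV. A i j * (\<psi> j * (w i - w j)))"
    by (subst sum.swap) (simp add: assms)
  ultimately have "2 * ?S = (\<Sum>i\<in>UNIV. \<Sum>j\<in>UNIV. A i j * (\<psi> i * (w j - w i)))
      + (\<Sum>i\<in>UNIV. \<Sum>j\<in>UNIV. A i j * (\<psi> j * (w i - w j)))"
    by simp
  also have "\<dots> = - (\<Sum>i\<in>UNIV. \<Sum>j\<in>UNIV. A i j * ((\<psi> i - \<psi> j) * (w i - w j)))"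
    by (simp add: sum_negf[symmetric] sum.distrib[symmetric] algebra_simps)
  finally show ?thesis by simp
qed

locale opinion_model =
  fixes p :: real and u :: "real^'n::finite" and M :: "real^'n^'n" and \<sigma> :: "real^'n"
  assumes p_pos: "0 < p" and params: "(u, M, \<sigma>) \<in> model_params" and anchored: "anchored (u, M, \<sigma>)"
begin

abbreviation "f \<equiv> opinion_field p (u, M, \<sigma>)"

lemma u_pos: "0 < u $ i" and M_sym: "M $ i $ j = M $ j $ i" and M_nonneg: "0 \<le> M $ i $ j"
  and sigma_nonneg: "0 \<le> \<sigma> $ i"
  using params by (auto simp: model_params_def)

lemma field_nth:
  "f x $ i = (\<Sum>j\<in>UNIV. M $ i $ j * (x $ j - x $ i)) + \<sigma> $ i * (u $ i - x $ i powr p) * x $ i"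
  by (simp add: opinion_field_def)

text \<open>This is the dissipation at \<open>y = x - z\<close> with the reaction factor
  \<open>(w - 1) * (w * (w powr p - 1))\<close> replaced by \<open>(w - 1)\<^sup>2\<close>. The
  result is a quadratic form, to which compactness of the sphere applies.\<close>

definition energy :: "real^'n \<Rightarrow> real^'n \<Rightarrow> real" where
  "energy z y = (1 / 2) * (\<Sum>i\<in>UNIV. \<Sum>j\<in>UNIV. M $ i $ j * z $ i * z $ j * (y $ i / z $ i - y $ j / z $ j)\<^sup>2)
     + (\<Sum>i\<in>UNIV. \<sigma> $ i * z $ i powr (p + 2) * (y $ i / z $ i)\<^sup>2)"

text \<open>This is where anchoring enters. If the form vanishes, the ratios \<open>y / z\<close>
  agree along every edge and are zero at stubborn agents; a path from each agent to a stubborn one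
  forces \<open>y = 0\<close>.\<close>

lemma energy_pos:
  assumes z: "z \<in> pos_orthant" and "y \<noteq> 0"
  shows "0 < energy z y"
proof (rule ccontr)
  have z_pos: "0 < z $ i" for i using z by (simp add: pos_orthant_def)
  let ?A = "\<lambda>i j. M $ i $ j * z $ i * z $ j * (y $ i / z $ i - y $ j / z $ j)\<^sup>2"
  let ?s = "\<lambda>i. \<sigma> $ i * z $ i powr (p + 2) * (y $ i / z $ i)\<^sup>2"
  have nonneg: "0 \<le> ?A i j" "0 \<le> ?s i" for i j
    using z_pos[of i] z_pos[of j] M_nonneg[of i j] sigma_nonneg[of i] by auto
  have ge: "0 \<le> (\<Sum>i\<in>UNIV. \<Sum>j\<in>UNIV. ?A i j)" "0 \<le> (\<Sum>i\<in>UNIV. ?s i)"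
    by (intro sum_nonneg nonneg)+
  assume "\<not> 0 < energy z y"
  then have "(\<Sum>i\<in>UNIV. \<Sum>j\<in>UNIV. ?A i j) = 0" "(\<Sum>i\<in>UNIV. ?s i) = 0"
    using ge by (auto simp: energy_def)
  then have zero: "?A i j = 0" "?s i = 0" for i j
    by (auto simp: sum_nonneg_eq_0_iff sum_nonneg nonneg simp del: mult_eq_0_iff)
  have step: "y $ i / z $ i = y $ j / z $ j" if "0 < M $ i $ j" for i j
    using zero(1)[of i j] that z_pos[of i] z_pos[of j] by auto
  have "y $ i = 0" for i
  proof -
    obtain j where j: "(i, j) \<in> {(k, l). 0 < M $ k $ l}\<^sup>*" "0 < \<sigma> $ j"
      using anchored by (auto simp: anchored_def)
    have "y $ i / z $ i = y $ j / z $ j"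
      using j(1) by (induction rule: rtrancl_induct) (use step in auto)
    moreover have "y $ j = 0"
      using zero(2)[of j] j(2) z_pos[of j] by auto
    ultimately show ?thesis using z_pos[of i] by auto
  qed
  then show False using assms(2) by (simp add: vec_eq_iff)
qed

text \<open>The constant is the minimum over the unit sphere, transported to all vectors by
  homogeneity of degree two.\<close>

lemma energy_coercive:
  assumes z: "z \<in> pos_orthant"
  obtains c where "0 < c" "\<And>y. c * (norm y)\<^sup>2 \<le> energy z y"
proof -
  have z_nz: "z $ i \<noteq> 0" for i using z by (simp add: pos_orthant_def less_imp_neq[symmetric])
  have "\<exists>y\<in>sphere 0 1. \<forall>v\<in>sphere 0 1. energy z y \<le> energy z v"
    by (rule continuous_attains_inf) (auto simp: energy_def z_nz intro!: continuous_intros)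
  then obtain y where y: "norm y = 1" and min: "\<And>v. norm v = 1 \<Longrightarrow> energy z y \<le> energy z v"
    by auto
  show thesis
  proof
    show "0 < energy z y" using y by (intro energy_pos[OF z]) auto
    show "energy z y * (norm v)\<^sup>2 \<le> energy z v" for v
    proof (cases "v = 0")
      case False
      define k where "k = norm v"
      have k: "0 < k" using False by (simp add: k_def)
      have scale: "energy z (a *\<^sub>R v) = a\<^sup>2 * energy z v" for a
      proof -
        have "a * v $ i / z $ i - a * v $ j / z $ j = a * (v $ i / z $ i - v $ j / z $ j)" for i j
          by (simp add: algebra_simps)
        then have "(a * v $ i / z $ i - a * v $ j / z $ j)\<^sup>2 = a\<^sup>2 * (v $ i / z $ i - v $ j / z $ j)\<^sup>2" for i j
          by (simp only: power_mult_distrib)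
        then show ?thesis
          by (simp add: energy_def power_mult_distrib power_divide sum_distrib_left algebra_simps)
      qed
      have "energy z y \<le> energy z ((1 / k) *\<^sub>R v)"
        using k by (intro min) (simp add: k_def)
      also have "\<dots> = energy z v / k\<^sup>2"
        by (simp add: scale power_divide)
      finally show ?thesis using k by (simp add: k_def pos_le_divide_eq)
    qed (simp add: energy_def)
  qed
qed

text \<open>
  Testing \<open>\<Sum>i. z\<^sub>i \<psi>\<^sub>i f\<^sub>i(x)\<close> in the ratios \<open>w = x / z\<close> symmetrizes the coupling, because
  \<open>f z = 0\<close> removes the zeroth-order terms.
\<close>
lemma dissipation_identity:
  assumes z: "z \<in> pos_orthant" "f z = 0" and x: "x \<in> pos_orthant"
  shows "(\<Sum>i\<in>UNIV. \<psi> i * (z $ i * f x $ i)) =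
    - (1 / 2) * (\<Sum>i\<in>UNIV. \<Sum>j\<in>UNIV. M $ i $ j * z $ i * z $ j * ((\<psi> i - \<psi> j) * (x $ i / z $ i - x $ j / z $ j)))
    - (\<Sum>i\<in>UNIV. \<sigma> $ i * z $ i powr (p + 2) * (\<psi> i * (x $ i / z $ i * ((x $ i / z $ i) powr p - 1))))"
proof -
  define w where "w i = x $ i / z $ i" for i
  have z_pos: "0 < z $ i" and x_pos: "0 < x $ i" for i using z x by (auto simp: pos_orthant_def)
  have xw: "x $ i = z $ i * w i" and w_pos: "0 < w i" for i
    using z_pos[of i] x_pos[of i] by (auto simp: w_def)
  define A where "A i j = M $ i $ j * z $ i * z $ j" for i j
  define s where "s i = \<sigma> $ i * z $ i powr (p + 2)" for i
  have "z $ i * f x $ i = (\<Sum>j\<in>UNIV. A i j * (w j - w i)) - s i * (w i * (w i powr p - 1))" for i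
  proof -
    \<comment> \<open>Subtracting this multiple of zero eliminates \<open>u $ i\<close> and
      collapses the coupling to \<open>M $ i $ j * z $ i * z $ j * (w j - w i)\<close>, whose weight
      is symmetric.\<close>
    have "z $ i * f x $ i = z $ i * f x $ i - w i * (z $ i * f z $ i)"
      using z(2) by simp
    also have "\<dots> = (\<Sum>j\<in>UNIV. z $ i * (M $ i $ j * (z $ j * w j - z $ i * w i)))
        - (\<Sum>j\<in>UNIV. w i * (z $ i * (M $ i $ j * (z $ j - z $ i))))
        + \<sigma> $ i * (z $ i * z $ i) * w i * (z $ i powr p - (z $ i * w i) powr p)"
      unfolding field_nth xw distrib_left sum_distrib_left by (simp add: algebra_simps)
    also have "(z $ i * w i) powr p = z $ i powr p * w i powr p"
      using z_pos[of i] w_pos[of i] by (simp add: powr_mult)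
    also have "\<sigma> $ i * (z $ i * z $ i) * w i * (z $ i powr p - z $ i powr p * w i powr p)
        = - s i * (w i * (w i powr p - 1))"
      using z_pos[of i] by (simp add: s_def powr_add power2_eq_square algebra_simps)
    finally show ?thesis
      by (simp add: A_def sum_subtractf[symmetric] algebra_simps)
  qed
  then have "(\<Sum>i\<in>UNIV. \<psi> i * (z $ i * f x $ i)) =
      (\<Sum>i\<in>UNIV. \<psi> i * (\<Sum>j\<in>UNIV. A i j * (w j - w i))) - (\<Sum>i\<in>UNIV. s i * (\<psi> i * (w i * (w i powr p - 1))))"
    by (simp only: right_diff_distrib sum_subtractf mult.left_commute[of "\<psi> _" "s _"])
  moreover have "A i j = A j i" for i j using M_sym[of i j] by (simp add: A_def)
  ultimately show ?thesis
    by (simp add: sum_symmetrize w_def A_def s_def)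
qed

text \<open>With \<open>\<psi> = w - 1\<close> the identity becomes an upper bound by the energy.
  The rate depends on \<open>\<eta>\<close> alone, not on \<open>x\<close>, so it is uniform on the
  unbounded region where \<open>x \<ge> \<eta> z\<close> componentwise.\<close>

lemma strict_dissipation:
  assumes z: "z \<in> pos_orthant" "f z = 0" and \<eta>: "0 < \<eta>" "\<eta> \<le> 1"
  obtains c where "0 < c"
    "\<And>x. x \<in> pos_orthant \<Longrightarrow> (\<And>i. \<eta> * z $ i \<le> x $ i) \<Longrightarrow> (x - z) \<bullet> f x \<le> - c * (norm (x - z))\<^sup>2"
proof -
  define \<kappa> where "\<kappa> = p * \<eta> powr (p + 1)"
  have \<kappa>: "0 < \<kappa>" using p_pos \<eta> by (simp add: \<kappa>_def)
  obtain c where c: "0 < c" "\<And>y. c * (norm y)\<^sup>2 \<le> energy z y" using energy_coercive[OF z(1)] by blast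
  have z_pos: "0 < z $ i" for i using z by (simp add: pos_orthant_def)
  show thesis
  proof
    \<comment> \<open>The coupling term matches the energy with factor 1, the reaction term only
      with factor \<open>\<kappa>\<close>; the smaller of the two serves both.\<close>
    show "0 < min 1 \<kappa> * c" using \<kappa> c by simp
    fix x assume x: "x \<in> pos_orthant" and ge: "\<And>i. \<eta> * z $ i \<le> x $ i"
    define w where "w i = x $ i / z $ i" for i
    have y: "(x - z) $ i / z $ i = w i - 1" for i
      using z_pos[of i] by (simp add: w_def diff_divide_distrib)
    let ?D = "\<Sum>i\<in>UNIV. \<Sum>j\<in>UNIV. M $ i $ j * z $ i * z $ j * ((w i - 1) - (w j - 1))\<^sup>2"
    let ?s = "\<lambda>i. \<sigma> $ i * z $ i powr (p + 2)"
    have D: "0 \<le> ?D"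
      by (intro sum_nonneg mult_nonneg_nonneg M_nonneg z_pos less_imp_le[OF z_pos] zero_le_power2)
    have s: "0 \<le> ?s i" for i using sigma_nonneg by simp
    have "min 1 \<kappa> * c * (norm (x - z))\<^sup>2 \<le> min 1 \<kappa> * energy z (x - z)"
      using c(2)[of "x - z"] \<kappa> by (simp add: mult.assoc mult_left_mono)
    also have "\<dots> = (1 / 2) * (min 1 \<kappa> * ?D) + (\<Sum>i\<in>UNIV. ?s i * (min 1 \<kappa> * (w i - 1)\<^sup>2))"
      unfolding energy_def y by (simp add: algebra_simps sum_distrib_left)
    also have "\<dots> \<le> (1 / 2) * ?D + (\<Sum>i\<in>UNIV. ?s i * ((w i - 1) * (w i * (w i powr p - 1))))"
    proof (intro add_mono mult_left_mono sum_mono s)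
      show "min 1 \<kappa> * ?D \<le> ?D" using D mult_right_mono[of "min 1 \<kappa>" 1 ?D] by simp
      fix i
      have "min 1 \<kappa> * (w i - 1)\<^sup>2 \<le> \<kappa> * (w i - 1)\<^sup>2"
        by (intro mult_right_mono) auto
      also have "\<dots> \<le> (w i - 1) * (w i * (w i powr p - 1))"
        unfolding \<kappa>_def using ge[of i] z_pos[of i]
        by (intro mult_powr_minus_one_ge p_pos \<eta>) (simp add: w_def pos_le_divide_eq)
      finally show "min 1 \<kappa> * (w i - 1)\<^sup>2 \<le> (w i - 1) * (w i * (w i powr p - 1))" .
    qed simp
    also have "\<dots> = - (\<Sum>i\<in>UNIV. (w i - 1) * (z $ i * f x $ i))"
      unfolding dissipation_identity[OF z x] w_def by (simp add: power2_eq_square)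
    also have "(\<Sum>i\<in>UNIV. (w i - 1) * (z $ i * f x $ i)) = (x - z) \<bullet> f x"
      unfolding inner_vec_def using z_pos
      by (intro sum.cong refl) (simp add: w_def field_simps less_imp_neq[symmetric])
    finally show "(x - z) \<bullet> f x \<le> - (min 1 \<kappa> * c) * (norm (x - z))\<^sup>2" by simp
  qed
qed

lemma ratio_lower_bound:
  assumes "z \<in> pos_orthant" "x \<in> pos_orthant"
  obtains \<eta> where "0 < \<eta>" "\<eta> \<le> 1" "\<And>i. \<eta> * z $ i \<le> x $ i"
proof
  let ?S = "insert 1 (range (\<lambda>i. x $ i / z $ i))"
  have pos: "0 < z $ i" "0 < x $ i" for i using assms by (auto simp: pos_orthant_def)
  show "0 < Min ?S" using pos by auto
  show "Min ?S \<le> 1" by simp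
  have "Min ?S \<le> x $ i / z $ i" for i by (rule Min_le) auto
  then show "Min ?S * z $ i \<le> x $ i" for i
    using pos_le_divide_eq[OF pos(1)[of i]] by blast
qed

section \<open>Uniqueness and existence of the steady state\<close>

lemma steady_state_unique:
  assumes z: "z \<in> pos_orthant" "f z = 0" and x: "x \<in> pos_orthant" "f x = 0"
  shows "x = z"
proof -
  obtain \<eta> where \<eta>: "0 < \<eta>" "\<eta> \<le> 1" "\<And>i. \<eta> * z $ i \<le> x $ i"
    using ratio_lower_bound[OF z(1) x(1)] by blast
  obtain c where "0 < c" "(x - z) \<bullet> f x \<le> - c * (norm (x - z))\<^sup>2"
    using strict_dissipation[OF z \<eta>(1,2)] x(1) \<eta>(3) by metis
  then show ?thesis using x(2) by (simp add: mult_le_0_iff)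
qed

text \<open>
  A fixed point of \<open>x + f x\<close> clamped to a box of constants \<open>a\<^sup>p \<le> u\<^sub>i \<le> b\<^sup>p\<close> is a zero of \<open>f\<close>,
  since \<open>f\<close> points into the box on its faces.
\<close>
lemma steady_state_exists:
  obtains z where "z \<in> pos_orthant" "f z = 0"
proof -
  obtain l m where l: "0 < l" "\<And>i. l \<le> u $ i" and m: "\<And>i. u $ i \<le> m"
  proof
    show "0 < Min (range (\<lambda>i. u $ i))" using u_pos by auto
    show "Min (range (\<lambda>i. u $ i)) \<le> u $ i" "u $ i \<le> Max (range (\<lambda>i. u $ i))" for i by auto
  qed
  define a where "a = l powr (1 / p)"
  define b where "b = m powr (1 / p)"
  have lm: "l \<le> m" using order_trans[OF l(2) m] .
  have a: "0 < a" "a powr p \<le> u $ i" and b: "u $ i \<le> b powr p" for i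
    using l(1) l(2)[of i] m[of i] lm p_pos by (auto simp: a_def b_def powr_powr)
  have ab: "a \<le> b"
    unfolding a_def b_def using l(1) p_pos lm by (intro powr_mono2) auto
  define h where "h x = (\<chi> i. max a (min b (x $ i + f x $ i)))" for x
  let ?B = "cbox (\<chi> i. a) (\<chi> i. b) :: (real^'n) set"
  have "x $ i \<noteq> 0" if "x \<in> ?B" for x i
    using that a(1) by (simp add: mem_box_cart) (metis not_less)
  then have cont: "continuous_on ?B h"
    unfolding h_def field_nth by (intro continuous_intros) auto
  have "h \<in> ?B \<rightarrow> ?B" using ab by (auto simp: h_def mem_box_cart)
  moreover have "?B \<noteq> {}" using ab by (simp add: interval_ne_empty_cart)
  ultimately obtain z where z: "z \<in> ?B" "h z = z"
    using brouwer[OF compact_cbox convex_box(1) _ cont] by blast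
  have za: "a \<le> z $ i" and zb: "z $ i \<le> b" for i using z(1) by (auto simp: mem_box_cart)
  have "f z $ i = 0" for i
  proof -
    have fix_i: "max a (min b (z $ i + f z $ i)) = z $ i"
      using arg_cong[OF z(2), of "\<lambda>v. v $ i"] by (simp add: h_def)
    \<comment> \<open>On a lower face every neighbour is at least \<open>a\<close> and
      \<open>a powr p \<le> u $ i\<close>, so coupling and reaction both push upwards; the upper
      face is symmetric.\<close>
    have "0 \<le> f z $ i" if "z $ i = a"
      unfolding field_nth that using za a(1) a(2)[of i]
      by (intro add_nonneg_nonneg sum_nonneg mult_nonneg_nonneg M_nonneg sigma_nonneg) auto
    moreover have "f z $ i \<le> 0" if "z $ i = b"
      unfolding field_nth that using zb b[of i] a(1) ab
      by (intro add_nonpos_nonpos sum_nonpos mult_nonneg_nonpos mult_nonpos_nonneg M_nonneg sigma_nonneg) auto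
    \<comment> \<open>Strictly inside, the clamp is inactive and the fixed point forces zero. On a
      face it only leaves an outward or zero component, and the signs above exclude the outward
      one.\<close>
    ultimately show ?thesis
      using fix_i za[of i] zb[of i] by (auto simp: max_def min_def split: if_splits)
  qed
  then have "f z = 0" by (simp add: vec_eq_iff)
  moreover have "z \<in> pos_orthant" using za a(1) by (auto simp: pos_orthant_def intro: less_le_trans)
  ultimately show thesis using that by blast
qed

abbreviation "equilibrium \<equiv> steady_state p (u, M, \<sigma>)"

lemma ex1_steady_state: "\<exists>!x. x \<in> pos_orthant \<and> f x = 0"
  using steady_state_exists steady_state_unique by metis

lemma steady_state: "equilibrium \<in> pos_orthant" "f equilibrium = 0"
  unfolding steady_state_def using theI'[OF ex1_steady_state] by auto

end

section \<open>Decay estimates and the Jacobian of the field\<close>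

lemma nonincreasing_of_nonpos_derivative:
  fixes \<phi> :: "real \<Rightarrow> real"
  assumes "a \<le> b" "\<And>s. s \<in> {a..b} \<Longrightarrow> (\<phi> has_real_derivative d s) (at s within {a..b})"
    and "\<And>s. s \<in> {a..b} \<Longrightarrow> d s \<le> 0"
  shows "\<phi> b \<le> \<phi> a"
proof -
  obtain s where s: "s \<in> {a..b}" "\<phi> b - \<phi> a = d s * (b - a)"
    using mvt_very_simple[OF assms(1), of \<phi> "\<lambda>s. (*) (d s)"] assms(2)
    by (auto simp: has_field_derivative_def)
  moreover have "d s * (b - a) \<le> 0"
    using assms(1) assms(3)[OF s(1)] by (simp add: mult_nonpos_nonneg)
  ultimately show ?thesis by simp
qed

text \<open>The quantity \<open>exp (2 * c * s) * (norm (x s - z))\<^sup>2\<close> does not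
  increase. Neither the sign of \<open>c\<close> nor the velocity \<open>v\<close> is restricted:
  \<open>c = 0\<close> yields invariance of balls, and \<open>v\<close> may come from a modified
  field.\<close>

lemma norm_exponential_decay:
  fixes x :: "real \<Rightarrow> 'a::real_inner"
  assumes t: "0 \<le> t"
    and der: "\<And>s. s \<in> {0..t} \<Longrightarrow> (x has_vector_derivative v s) (at s within {0..t})"
    and diss: "\<And>s. s \<in> {0..t} \<Longrightarrow> (x s - z) \<bullet> v s \<le> - c * (norm (x s - z))\<^sup>2"
  shows "norm (x t - z) \<le> exp (- c * t) * norm (x 0 - z)"
proof -
  define \<phi> where "\<phi> s = exp (2 * c * s) * ((x s - z) \<bullet> (x s - z))" for s
  have "\<phi> t \<le> \<phi> 0"
  proof (rule nonincreasing_of_nonpos_derivative[OF t])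
    fix s assume s: "s \<in> {0..t}"
    show "(\<phi> has_real_derivative exp (2 * c * s) * (2 * (c * (norm (x s - z))\<^sup>2 + (x s - z) \<bullet> v s)))
        (at s within {0..t})"
      unfolding \<phi>_def has_field_derivative_def
      using der[OF s, unfolded has_vector_derivative_def]
      by (auto intro!: derivative_eq_intros
        simp: fun_eq_iff power2_norm_eq_inner inner_commute algebra_simps)
    show "exp (2 * c * s) * (2 * (c * (norm (x s - z))\<^sup>2 + (x s - z) \<bullet> v s)) \<le> 0"
      using diss[OF s] by (intro mult_nonneg_nonpos) auto
  qed
  then have "(exp (c * t) * norm (x t - z))\<^sup>2 \<le> (norm (x 0 - z))\<^sup>2"
    by (simp add: \<phi>_def power2_norm_eq_inner power_mult_distrib exp_double[symmetric] mult.assoc)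
  then have "exp (c * t) * norm (x t - z) \<le> norm (x 0 - z)"
    by (rule power2_le_imp_le) simp
  then show ?thesis by (simp add: exp_minus field_simps)
qed

text \<open>The projection is radial, so a projected point differs from the centre by a nonnegative
  multiple of \<open>x - z\<close>. Dissipation at the projected point thus carries over to
  \<open>x\<close>.\<close>

lemma closest_point_cball:
  fixes z :: "'a::euclidean_space"
  assumes "0 \<le> \<delta>" "\<delta> < norm (x - z)"
  shows "closest_point (cball z \<delta>) x = z + (\<delta> / norm (x - z)) *\<^sub>R (x - z)"
proof (rule sym, rule closest_point_unique[OF convex_cball closed_cball])
  let ?y = "z + (\<delta> / norm (x - z)) *\<^sub>R (x - z)"
  have pos: "0 < norm (x - z)" using assms by linarith
  show "?y \<in> cball z \<delta>" using assms(1) pos by (simp add: dist_norm)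
  have "x - ?y = (1 - \<delta> / norm (x - z)) *\<^sub>R (x - z)" by (simp add: algebra_simps)
  then have "dist x ?y = \<bar>1 - \<delta> / norm (x - z)\<bar> * norm (x - z)" by (simp only: dist_norm norm_scaleR)
  also have "\<dots> = norm (x - z) - \<delta>" using assms pos by (simp add: abs_of_nonneg field_simps)
  finally have dist: "dist x ?y = norm (x - z) - \<delta>" .
  show "\<forall>y\<in>cball z \<delta>. dist x ?y \<le> dist x y"
  proof
    fix y assume "y \<in> cball z \<delta>"
    then show "dist x ?y \<le> dist x y"
      unfolding dist using dist_triangle[of x z y] by (simp add: dist_commute dist_norm[of x z])
  qed
qed

section \<open>Derivatives of the field in state and parameters\<close>

lemma has_derivative_vec_lambda:
  fixes f :: "'a::real_normed_vector \<Rightarrow> real^'n"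
  assumes "\<And>i. ((\<lambda>x. f x $ i) has_derivative (\<lambda>h. f' h $ i)) (at x within S)"
  shows "(f has_derivative f') (at x within S)"
  by (subst has_derivative_componentwise_within) (auto simp: Basis_vec_def inner_axis assms)

text \<open>The derivative of the field in the state; \<open>p + 1\<close> comes from
  differentiating \<open>x powr p * x\<close>. Projections stand in for a pattern on the triple, so
  that the entries can be treated as functions of the parameters too.\<close>

definition opinion_jacobian :: "real \<Rightarrow> 'n::finite opinion_params \<Rightarrow> real^'n \<Rightarrow> real^'n^'n" where
  "opinion_jacobian p \<theta> x = (\<chi> i j. fst (snd \<theta>) $ i $ j +
     (if i = j then snd (snd \<theta>) $ i * (fst \<theta> $ i - (p + 1) * x $ i powr p)
        - (\<Sum>k\<in>UNIV. fst (snd \<theta>) $ i $ k) else 0))"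

definition opinion_param_derivative ::
    "real \<Rightarrow> 'n::finite opinion_params \<Rightarrow> real^'n \<Rightarrow> 'n opinion_params \<Rightarrow> real^'n" where
  "opinion_param_derivative p \<theta> x v = (\<chi> i. (\<Sum>j\<in>UNIV. fst (snd v) $ i $ j * (x $ j - x $ i)) +
     (snd (snd v) $ i * (fst \<theta> $ i - x $ i powr p) + snd (snd \<theta>) $ i * fst v $ i) * x $ i)"

lemma opinion_field_nth:
  "opinion_field p \<theta> x $ i = (\<Sum>j\<in>UNIV. fst (snd \<theta>) $ i $ j * (x $ j - x $ i)) +
     snd (snd \<theta>) $ i * (fst \<theta> $ i - x $ i powr p) * x $ i"
  by (simp add: opinion_field_def split_beta)

lemma opinion_jacobian_mult:
  "(opinion_jacobian p \<theta> x *v v) $ i = (\<Sum>j\<in>UNIV. fst (snd \<theta>) $ i $ j * (v $ j - v $ i)) +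
     snd (snd \<theta>) $ i * (fst \<theta> $ i - (p + 1) * x $ i powr p) * v $ i"
proof -
  define d where "d = snd (snd \<theta>) $ i * (fst \<theta> $ i - (p + 1) * x $ i powr p) - (\<Sum>k\<in>UNIV. fst (snd \<theta>) $ i $ k)"
  have "opinion_jacobian p \<theta> x $ i $ j * v $ j = fst (snd \<theta>) $ i $ j * v $ j + (if i = j then d * v $ i else 0)" for j
    by (simp add: opinion_jacobian_def d_def distrib_right)
  then have "(opinion_jacobian p \<theta> x *v v) $ i = (\<Sum>j\<in>UNIV. fst (snd \<theta>) $ i $ j * v $ j) + d * v $ i"
    by (simp add: matrix_vector_mult_def sum.distrib)
  then show ?thesis
    by (simp add: d_def right_diff_distrib sum_subtractf sum_distrib_left algebra_simps)
qed

text \<open>Only the state must be positive, for the sake of \<open>powr\<close>. The parameters are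
  unrestricted, as the smooth extension requires.\<close>

lemma has_derivative_opinion_field:
  assumes "x \<in> pos_orthant"
  shows "((\<lambda>q. opinion_field p (fst q) (snd q)) has_derivative
    (\<lambda>v. opinion_param_derivative p \<theta> x (fst v) + opinion_jacobian p \<theta> x *v snd v)) (at (\<theta>, x))"
proof (rule has_derivative_vec_lambda)
  fix i
  have x_pos: "0 < x $ i" using assms by (simp add: pos_orthant_def)
  note [derivative_intros] = bounded_linear.has_derivative[OF bounded_linear_vec_nth]
  show "((\<lambda>q. opinion_field p (fst q) (snd q) $ i) has_derivative
    (\<lambda>v. (opinion_param_derivative p \<theta> x (fst v) + opinion_jacobian p \<theta> x *v snd v) $ i)) (at (\<theta>, x))"
    unfolding opinion_field_nth vector_add_component opinion_jacobian_mult
    using x_pos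
    by (auto intro!: derivative_eq_intros simp: fun_eq_iff opinion_param_derivative_def sum.distrib sum_subtractf algebra_simps)
qed

lemma has_derivative_opinion_field_state:
  assumes "x \<in> pos_orthant"
  shows "(opinion_field p \<theta> has_derivative (*v) (opinion_jacobian p \<theta> x)) (at x)"
proof -
  have "((\<lambda>y. (\<theta>, y)) has_derivative (\<lambda>v. (0, v))) (at x)"
    by (auto intro!: derivative_eq_intros)
  from has_derivative_compose[OF this has_derivative_opinion_field[OF assms, of p \<theta>]]
  show ?thesis by (simp add: opinion_param_derivative_def zero_vec_def[symmetric])
qed

lemma continuous_on_opinion_jacobian:
  "continuous_on (UNIV \<times> pos_orthant)
    (\<lambda>q :: 'n::finite opinion_params \<times> (real^'n). opinion_jacobian p (fst q) (snd q))"
  (is "continuous_on ?S ?J")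
proof -
  have "continuous_on ?S (\<lambda>q. ?J q $ i $ j)" for i j
  proof -
    have [simp]: "x $ k \<noteq> 0" if "x \<in> pos_orthant" for x :: "real^'n" and k
      using that by (auto simp: pos_orthant_def dest: spec[of _ k])
    show ?thesis
      by (cases "i = j") (auto simp: opinion_jacobian_def intro!: continuous_intros)
  qed
  then have "continuous_on ?S (\<lambda>q. \<chi> i j. ?J q $ i $ j)"
    by (intro continuous_on_vec_lambda)
  then show ?thesis by simp
qed

text \<open>Mean value inequality: the operator norm of the Jacobian is at most the sum of its
  absolute entries, which is bounded on a compact set.\<close>

lemma opinion_field_lipschitz:
  assumes "compact S" "convex S" "S \<subseteq> pos_orthant"
  obtains L where "L-lipschitz_on S (opinion_field p \<theta>)"
proof -
  have "continuous_on S (\<lambda>x. opinion_jacobian p (fst (\<theta>, x)) (snd (\<theta>, x)))"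
    by (rule continuous_on_compose2[OF continuous_on_opinion_jacobian])
      (use assms in \<open>auto intro!: continuous_intros\<close>)
  then have "continuous_on S (opinion_jacobian p \<theta>)" by simp
  then have "continuous_on S (\<lambda>x. \<Sum>i\<in>UNIV. \<Sum>j\<in>UNIV. \<bar>opinion_jacobian p \<theta> x $ i $ j\<bar>)"
    by (intro continuous_intros)
  then have "bounded ((\<lambda>x. \<Sum>i\<in>UNIV. \<Sum>j\<in>UNIV. \<bar>opinion_jacobian p \<theta> x $ i $ j\<bar>) ` S)"
    using assms(1) compact_continuous_image compact_imp_bounded by blast
  then obtain B where B: "\<And>x. x \<in> S \<Longrightarrow> \<bar>\<Sum>i\<in>UNIV. \<Sum>j\<in>UNIV. \<bar>opinion_jacobian p \<theta> x $ i $ j\<bar>\<bar> \<le> B"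
    unfolding bounded_real by blast
  have "norm (opinion_field p \<theta> x - opinion_field p \<theta> y) \<le> \<bar>B\<bar> * norm (x - y)"
    if "x \<in> S" "y \<in> S" for x y
  proof (rule differentiable_bound[OF assms(2) _ _ that])
    show "(opinion_field p \<theta> has_derivative (*v) (opinion_jacobian p \<theta> x)) (at x within S)"
      if "x \<in> S" for x
      by (rule has_derivative_at_withinI, rule has_derivative_opinion_field_state) (use that assms(3) in auto)
    show "onorm ((*v) (opinion_jacobian p \<theta> x)) \<le> \<bar>B\<bar>" if "x \<in> S" for x
      using onorm_le_matrix_component_sum[of "opinion_jacobian p \<theta> x"] B[OF that] by linarith
  qed
  then have "\<bar>B\<bar>-lipschitz_on S (opinion_field p \<theta>)" by (auto simp: lipschitz_on_def dist_norm)
  then show thesis by (rule that)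
qed

section \<open>Dynamics and Nash equilibria\<close>

context opinion_model begin

text \<open>Here \<open>\<eta>\<close> depends on the point, so only the sign survives, but it does
  so on the whole orthant.\<close>

lemma dissipation_nonpos:
  assumes "x \<in> pos_orthant"
  shows "(x - equilibrium) \<bullet> f x \<le> 0"
proof -
  obtain \<eta> where \<eta>: "0 < \<eta>" "\<eta> \<le> 1" "\<And>i. \<eta> * equilibrium $ i \<le> x $ i"
    using ratio_lower_bound[OF steady_state(1) assms] by blast
  obtain c where c: "0 < c" "(x - equilibrium) \<bullet> f x \<le> - c * (norm (x - equilibrium))\<^sup>2"
    using strict_dissipation[OF steady_state \<eta>(1,2)] assms \<eta>(3) by metis
  have "0 \<le> c * (norm (x - equilibrium))\<^sup>2" using c(1) by simp
  then show ?thesis using c(2) by linarith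
qed

lemma solution_within:
  assumes "solves_ode_on f S I x" "{0..t} \<subseteq> I" "s \<in> {0..t}"
  shows "x s \<in> S" "(x has_vector_derivative f (x s)) (at s within {0..t})"
proof -
  have "s \<in> I" using assms(2,3) by blast
  then show "x s \<in> S" "(x has_vector_derivative f (x s)) (at s within {0..t})"
    using assms(1) has_vector_derivative_within_subset[OF _ assms(2)] by (auto simp: solves_ode_on_def)
qed

lemma equilibrium_neighbourhood:
  obtains \<delta> where "0 < \<delta>" "cball equilibrium \<delta> \<subseteq> pos_orthant"
    "\<And>x i. x \<in> cball equilibrium \<delta> \<Longrightarrow> (1 / 2) * equilibrium $ i \<le> x $ i"
proof -
  have pos: "0 < equilibrium $ i" for i using steady_state(1) by (simp add: pos_orthant_def)
  \<comment> \<open>Half the smallest coordinate keeps every ratio to the equilibrium at least 1/2,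
    the value of \<open>\<eta>\<close> used for local estimates.\<close>
  define \<delta> where "\<delta> = Min (range (\<lambda>i. equilibrium $ i)) / 2"
  have ge: "(1 / 2) * equilibrium $ i \<le> x $ i" if "x \<in> cball equilibrium \<delta>" for x i
  proof -
    have "\<bar>(equilibrium - x) $ i\<bar> \<le> \<delta>"
      using that component_le_norm_cart[of "equilibrium - x" i] by (simp add: dist_norm)
    moreover have "\<delta> \<le> equilibrium $ i / 2" unfolding \<delta>_def by simp
    ultimately show ?thesis by simp
  qed
  moreover have "x \<in> pos_orthant" if "x \<in> cball equilibrium \<delta>" for x
    unfolding pos_orthant_def
  proof (intro CollectI allI)
    show "0 < x $ i" for i using ge[OF that, of i] pos[of i] by linarith
  qed
  moreover have "0 < \<delta>" using pos by (auto simp: \<delta>_def)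
  ultimately show thesis using that by blast
qed

text \<open>The field composed with the projection onto the ball is bounded and Lipschitz
  everywhere, hence has global solutions. These never leave the ball, where the projection is the
  identity, so they solve the original equation.\<close>

lemma solution_exists:
  assumes \<delta>: "0 < \<delta>" "cball equilibrium \<delta> \<subseteq> pos_orthant" and x0: "x0 \<in> cball equilibrium \<delta>"
  obtains x where "x 0 = x0" "solves_ode_on f pos_orthant {0..} x"
proof -
  let ?B = "cball equilibrium \<delta>"
  define P where "P = closest_point ?B"
  have ne: "?B \<noteq> {}" using \<delta>(1) by simp
  have PB: "P x \<in> ?B" for x unfolding P_def using ne by (intro closest_point_in_set) auto
  have P_id: "P x = x" if "x \<in> ?B" for x using that by (simp add: P_def closest_point_self)
  obtain L where L: "L-lipschitz_on ?B f"
    using opinion_field_lipschitz[OF compact_cball convex_cball \<delta>(2)] by blast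
  have lipP: "1-lipschitz_on UNIV P"
    unfolding lipschitz_on_def P_def using closest_point_lipschitz[OF convex_cball closed_cball ne] by simp
  have "(L * 1)-lipschitz_on UNIV (\<lambda>x. f (P x))"
    by (rule lipschitz_on_compose2[OF lipP])
      (use PB in \<open>auto intro: lipschitz_on_subset[OF L]\<close>)
  moreover have "bounded (range (\<lambda>x. f (P x)))"
    by (rule bounded_subset[OF compact_imp_bounded[OF compact_continuous_image[OF lipschitz_on_continuous_on[OF L] compact_cball]]])
      (use PB in auto)
  ultimately obtain x where init: "x 0 = x0"
    and der: "\<And>t. 0 \<le> t \<Longrightarrow> (x has_vector_derivative f (P (x t))) (at t within {0..})"
    using bounded_lipschitz_ode_solution by blast
  have diss: "(y - equilibrium) \<bullet> f (P y) \<le> 0" for y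
  proof (cases "y \<in> ?B")
    case True
    then show ?thesis using dissipation_nonpos \<delta>(2) by (auto simp: P_id)
  next
    case False
    then have gt: "\<delta> < norm (y - equilibrium)" by (simp add: dist_norm norm_minus_commute)
    have "(\<delta> / norm (y - equilibrium)) * ((y - equilibrium) \<bullet> f (P y)) = (P y - equilibrium) \<bullet> f (P y)"
      using closest_point_cball[OF less_imp_le[OF \<delta>(1)] gt] by (simp add: P_def)
    also have "\<dots> \<le> 0" using dissipation_nonpos PB \<delta>(2) by blast
    finally show ?thesis
      using divide_pos_pos[OF \<delta>(1) less_trans[OF \<delta>(1) gt]] unfolding mult_le_0_iff by linarith
  qed
  have xB: "x t \<in> ?B" if t: "0 \<le> t" for t
  proof -
    \<comment> \<open>Rate zero: the distance does not increase, so the ball is invariant.\<close>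
    have "norm (x t - equilibrium) \<le> exp (- 0 * t) * norm (x 0 - equilibrium)"
      by (rule norm_exponential_decay[OF t, where v = "\<lambda>s. f (P (x s))"])
        (use diss in \<open>auto intro: has_vector_derivative_within_subset[OF der]\<close>)
    then show ?thesis using x0 init by (simp add: dist_norm norm_minus_commute)
  qed
  show thesis
  proof (rule that)
    show "x 0 = x0" by (rule init)
    show "solves_ode_on f pos_orthant {0..} x"
      unfolding solves_ode_on_def using der xB \<delta>(2) P_id by fastforce
  qed
qed

text \<open>The decay estimate is applied twice: with rate zero it traps a solution in the ball, and
  there the uniform rate for \<open>\<eta> = 1 / 2\<close> is available. The distance itself decays,
  so the constant \<open>C\<close> is 1.\<close>

lemma exponentially_stable: "locally_exponentially_stable f pos_orthant equilibrium"
proof -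
  obtain \<delta> where \<delta>: "0 < \<delta>" "cball equilibrium \<delta> \<subseteq> pos_orthant"
    "\<And>x i. x \<in> cball equilibrium \<delta> \<Longrightarrow> (1 / 2) * equilibrium $ i \<le> x $ i"
    using equilibrium_neighbourhood by blast
  obtain c where c: "0 < c" "\<And>x. x \<in> pos_orthant \<Longrightarrow> (\<And>i. (1 / 2) * equilibrium $ i \<le> x $ i) \<Longrightarrow>
      (x - equilibrium) \<bullet> f x \<le> - c * (norm (x - equilibrium))\<^sup>2"
    using strict_dissipation[OF steady_state, of "1 / 2"] by auto
  have decay: "norm (x t - equilibrium) \<le> 1 * exp (- c * t) * norm (x0 - equilibrium)"
    if near: "norm (x0 - equilibrium) < \<delta>" and init: "x 0 = x0"
      and sol: "solves_ode_on f pos_orthant {0..<T} x" and t: "t \<in> {0..<T}" for x0 x T t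
  proof -
    have sub: "{0..s} \<subseteq> {0..<T}" if "s \<in> {0..t}" for s using t that by auto
    have cball: "x s \<in> cball equilibrium \<delta>" if s: "s \<in> {0..t}" for s
    proof -
      have "norm (x s - equilibrium) \<le> exp (- 0 * s) * norm (x 0 - equilibrium)"
        by (rule norm_exponential_decay[where v = "\<lambda>s. f (x s)"])
          (use s solution_within[OF sol sub[OF s]] dissipation_nonpos in auto)
      then show ?thesis using near init by (simp add: dist_norm norm_minus_commute)
    qed
    have "norm (x t - equilibrium) \<le> exp (- c * t) * norm (x 0 - equilibrium)"
    proof (rule norm_exponential_decay[where v = "\<lambda>s. f (x s)"])
      show "(x s - equilibrium) \<bullet> f (x s) \<le> - c * (norm (x s - equilibrium))\<^sup>2" if "s \<in> {0..t}" for s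
        using cball[OF that] \<delta> by (intro c(2)) auto
    qed (use t solution_within(2)[OF sol sub] in auto)
    then show ?thesis using init by simp
  qed
  show ?thesis
    unfolding locally_exponentially_stable_def
  proof (rule conjI[OF steady_state(1)], rule conjI[OF steady_state(2)], rule exI[of _ \<delta>],
      rule conjI[OF \<delta>(1)], rule exI[of _ "1::real"], rule conjI[OF zero_less_one], rule exI[of _ c],
      rule conjI[OF c(1)], intro conjI ballI impI allI)
    fix x0 assume near: "norm (x0 - equilibrium) < \<delta>"
    then have "x0 \<in> cball equilibrium \<delta>" by (simp add: dist_norm norm_minus_commute)
    from solution_exists[OF \<delta>(1,2) this]
    show "\<exists>x. x 0 = x0 \<and> solves_ode_on f pos_orthant {0..} x" by metis
    show "norm (x t - equilibrium) \<le> 1 * exp (- c * t) * norm (x0 - equilibrium)"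
      if "x 0 = x0 \<and> solves_ode_on f pos_orthant {0..<T} x" "t \<in> {0..<T}" for T x t
      using decay[OF near] that by blast
  qed
qed

text \<open>
  The entropy \<open>\<Sum>i. z\<^sub>i\<^sup>2 (w\<^sub>i - 1 - ln w\<^sub>i)\<close> of the ratios \<open>w = x / z\<close> is another Lyapunov
  function; it keeps trajectories away from the boundary of the orthant.
\<close>
lemma solution_ratio_bound:
  assumes sol: "solves_ode_on f pos_orthant {0..} x"
  obtains \<eta> where "0 < \<eta>" "\<eta> \<le> 1" "\<And>t i. 0 \<le> t \<Longrightarrow> \<eta> * equilibrium $ i \<le> x t $ i"
proof -
  define z where "z = equilibrium"
  define w where "w t i = x t $ i / z $ i" for t i
  define V where "V t = (\<Sum>i\<in>UNIV. (z $ i)\<^sup>2 * (w t i - 1 - ln (w t i)))" for t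
  have z: "z \<in> pos_orthant" "f z = 0" and z_pos: "0 < z $ i" for i
    using steady_state by (auto simp: z_def pos_orthant_def)
  have x: "x t \<in> pos_orthant" and w_pos: "0 < w t i" if "0 \<le> t" for t i
    using sol that z_pos by (auto simp: solves_ode_on_def pos_orthant_def w_def)
  have V_le: "V t \<le> V 0" if t: "0 \<le> t" for t
  proof (rule nonincreasing_of_nonpos_derivative[OF t])
    fix s assume s: "s \<in> {0..t}"
    have ws: "0 < w s i" for i using s w_pos by simp
    have dx: "((\<lambda>s. x s $ i) has_real_derivative f (x s) $ i) (at s within {0..t})" for i
      using bounded_linear.has_vector_derivative[OF bounded_linear_vec_nth solution_within(2)[OF sol _ s]]
      by (simp add: has_real_derivative_iff_has_vector_derivative)
    have dw: "((\<lambda>s. w s i) has_real_derivative f (x s) $ i / z $ i) (at s within {0..t})" for i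
      unfolding w_def by (rule DERIV_cdivide[OF dx])
    \<comment> \<open>The weight \<open>(z $ i)\<^sup>2\<close> turns the factor
      \<open>1 / z $ i\<close> from the ratio into \<open>z $ i\<close>, as
      \<open>dissipation_identity\<close> requires for \<open>\<psi> = 1 - 1 / w\<close>.\<close>
    have "((\<lambda>s. (z $ i)\<^sup>2 * (w s i - 1 - ln (w s i))) has_real_derivative
        (1 - 1 / w s i) * (z $ i * f (x s) $ i)) (at s within {0..t})" for i
      using ws[of i] z_pos[of i]
      by (auto intro!: derivative_eq_intros dw simp: field_simps power2_eq_square)
    then show "(V has_real_derivative (\<Sum>i\<in>UNIV. (1 - 1 / w s i) * (z $ i * f (x s) $ i))) (at s within {0..t})"
      unfolding V_def by (intro DERIV_sum)
    \<comment> \<open>The multiplier is an increasing function of the ratio, so the coupling cannot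
      raise the entropy.\<close>
    have mono: "0 \<le> ((1 - 1 / w s i) - (1 - 1 / w s j)) * (w s i - w s j)" for i j
    proof -
      have "((1 - 1 / w s i) - (1 - 1 / w s j)) * (w s i - w s j) = (w s i - w s j)\<^sup>2 / (w s i * w s j)"
        using ws[of i] ws[of j] by (simp add: field_simps power2_eq_square)
      also have "\<dots> \<ge> 0" using ws[of i] ws[of j] by simp
      finally show ?thesis .
    qed
    have "0 \<le> (\<Sum>i\<in>UNIV. \<Sum>j\<in>UNIV. M $ i $ j * z $ i * z $ j *
        (((1 - 1 / w s i) - (1 - 1 / w s j)) * (w s i - w s j)))"
      by (intro sum_nonneg mult_nonneg_nonneg[OF _ mono])
        (intro mult_nonneg_nonneg M_nonneg less_imp_le[OF z_pos])
    moreover have reaction: "0 \<le> (1 - 1 / w s i) * (w s i * (w s i powr p - 1))" for i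
    proof -
      have "0 \<le> p * min 1 (w s i) powr (p + 1) * (w s i - 1)\<^sup>2" using p_pos by simp
      also have "\<dots> \<le> (w s i - 1) * (w s i * (w s i powr p - 1))"
        using ws[of i] by (intro mult_powr_minus_one_ge p_pos) auto
      also have "\<dots> = w s i * ((1 - 1 / w s i) * (w s i * (w s i powr p - 1)))"
        using ws[of i] by (simp add: field_simps)
      finally show ?thesis using ws[of i] by (simp add: zero_le_mult_iff)
    qed
    have "0 \<le> (\<Sum>i\<in>UNIV. \<sigma> $ i * z $ i powr (p + 2) * ((1 - 1 / w s i) * (w s i * (w s i powr p - 1))))"
      by (intro sum_nonneg mult_nonneg_nonneg[OF _ reaction] mult_nonneg_nonneg sigma_nonneg) auto
    ultimately show "(\<Sum>i\<in>UNIV. (1 - 1 / w s i) * (z $ i * f (x s) $ i)) \<le> 0"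
      using dissipation_identity[OF z x[of s], of "\<lambda>i. 1 - 1 / w s i"] s by (simp add: w_def)
  qed
  have V0: "0 \<le> V 0"
    unfolding V_def using ln_le_minus_one[OF w_pos[of 0]]
    by (intro sum_nonneg mult_nonneg_nonneg) auto
  \<comment> \<open>All summands of \<open>V\<close> are nonnegative, so each is at most
    \<open>V 0\<close>. Dropping the positive \<open>w\<close> from \<open>w - 1 - ln w\<close>
    leaves a lower bound for \<open>ln w\<close>.\<close>
  define \<eta> where "\<eta> = Min (range (\<lambda>i. exp (- V 0 / (z $ i)\<^sup>2 - 1)))"
  have "\<eta> \<le> w t i" if t: "0 \<le> t" for t i
  proof -
    have "(z $ i)\<^sup>2 * (w t i - 1 - ln (w t i)) \<le> V t"
      unfolding V_def using ln_le_minus_one[OF w_pos[OF t]]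
      by (intro member_le_sum mult_nonneg_nonneg) auto
    also have "\<dots> \<le> V 0" by (rule V_le[OF t])
    finally have "w t i - 1 - ln (w t i) \<le> V 0 / (z $ i)\<^sup>2"
      using z_pos[of i] by (simp add: pos_le_divide_eq mult.commute)
    then have "- V 0 / (z $ i)\<^sup>2 - 1 \<le> ln (w t i)" using w_pos[OF t, of i] by simp
    then have "exp (- V 0 / (z $ i)\<^sup>2 - 1) \<le> w t i" using w_pos[OF t, of i] by (simp add: ln_ge_iff)
    then show ?thesis unfolding \<eta>_def by (rule order_trans[OF Min_le, rotated 2]) auto
  qed
  then have "\<eta> * z $ i \<le> x t $ i" if "0 \<le> t" for t i
    using that z_pos[of i] pos_le_divide_eq by (fastforce simp: w_def)
  moreover have "0 < \<eta>" by (auto simp: \<eta>_def)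
  moreover have "\<eta> \<le> 1"
  proof -
    \<comment> \<open>\<open>undefined\<close> merely names some index; any of the exponentials is
      at most 1 because \<open>V 0\<close> is nonnegative.\<close>
    have "\<eta> \<le> exp (- V 0 / (z $ undefined)\<^sup>2 - 1)" unfolding \<eta>_def by (rule Min_le) auto
    also have "\<dots> \<le> exp 0"
      using divide_nonneg_nonneg[OF V0 zero_le_power2[of "z $ undefined"]]
      unfolding exp_le_cancel_iff minus_divide_left[symmetric] by linarith
    finally show ?thesis by simp
  qed
  ultimately show thesis using that unfolding z_def by blast
qed

text \<open>One \<open>\<eta>\<close> serves the whole trajectory, so strict dissipation holds at
  all times with a single rate. This rate may depend on the solution.\<close>

lemma solution_converges:
  assumes sol: "solves_ode_on f pos_orthant {0..} x"
  shows "(x \<longlongrightarrow> equilibrium) at_top"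
proof -
  obtain \<eta> where \<eta>: "0 < \<eta>" "\<eta> \<le> 1" "\<And>t i. 0 \<le> t \<Longrightarrow> \<eta> * equilibrium $ i \<le> x t $ i"
    using solution_ratio_bound[OF sol] by blast
  obtain c where c: "0 < c" "\<And>x. x \<in> pos_orthant \<Longrightarrow> (\<And>i. \<eta> * equilibrium $ i \<le> x $ i) \<Longrightarrow>
      (x - equilibrium) \<bullet> f x \<le> - c * (norm (x - equilibrium))\<^sup>2"
    using strict_dissipation[OF steady_state \<eta>(1,2)] by blast
  have decay: "norm (x t - equilibrium) \<le> exp (- c * t) * norm (x 0 - equilibrium)" if "0 \<le> t" for t
  proof (rule norm_exponential_decay[OF that, where v = "\<lambda>s. f (x s)"])
    have sub: "{0..t} \<subseteq> {0..}" by auto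
    show "(x has_vector_derivative f (x s)) (at s within {0..t})" if "s \<in> {0..t}" for s
      by (rule solution_within(2)[OF sol sub that])
    show "(x s - equilibrium) \<bullet> f (x s) \<le> - c * (norm (x s - equilibrium))\<^sup>2" if "s \<in> {0..t}" for s
      using solution_within(1)[OF sol sub that] that \<eta>(3) by (intro c(2)) auto
  qed
  have "filterlim (\<lambda>t. - c * t) at_bot at_top"
    using c(1) by (intro filterlim_tendsto_neg_mult_at_bot[OF tendsto_const _ filterlim_ident]) auto
  then have "((\<lambda>t. exp (- c * t)) \<longlongrightarrow> 0) at_top"
    by (rule filterlim_compose[OF exp_at_bot])
  then have "((\<lambda>t. exp (- c * t) * norm (x 0 - equilibrium)) \<longlongrightarrow> 0) at_top"
    by (rule tendsto_mult_left_zero)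
  then have "((\<lambda>t. x t - equilibrium) \<longlongrightarrow> 0) at_top"
    by (rule Lim_null_comparison[rotated]) (use decay in \<open>auto intro: eventually_at_top_linorderI[of 0]\<close>)
  then show ?thesis by (simp add: LIM_zero_iff)
qed

section \<open>Nash equilibria: the field as each player's negative cost derivative\<close>

lemma player_cost_has_derivative:
  assumes "0 < r"
  shows "((\<lambda>r. player_cost p (u, M, \<sigma>) i (\<chi> k. if k = i then r else x $ k)) has_real_derivative
    - f (\<chi> k. if k = i then r else x $ k) $ i) (at r)"
proof -
  have "((\<lambda>r. M $ i $ j * (r - (if j = i then r else x $ j))\<^sup>2) has_real_derivative
      2 * (M $ i $ j * (r - (if j = i then r else x $ j)))) (at r)" for j
    by (cases "j = i") (auto intro!: derivative_eq_intros)
  then have "((\<lambda>r. \<Sum>j\<in>UNIV. M $ i $ j * (r - (if j = i then r else x $ j))\<^sup>2) has_real_derivative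
      (\<Sum>j\<in>UNIV. 2 * (M $ i $ j * (r - (if j = i then r else x $ j))))) (at r)"
    by (intro DERIV_sum)
  note [derivative_intros] = this
  have "((\<lambda>r. player_cost p (u, M, \<sigma>) i (\<chi> k. if k = i then r else x $ k)) has_real_derivative
      (\<Sum>j\<in>UNIV. M $ i $ j * (r - (if j = i then r else x $ j))) + \<sigma> $ i * (r powr (p + 1) - u $ i * r)) (at r)"
    unfolding player_cost_def using assms p_pos
    by (auto intro!: derivative_eq_intros simp: sum_distrib_left[symmetric] add.commute[of 1 p])
  moreover have "(\<Sum>j\<in>UNIV. M $ i $ j * (r - (if j = i then r else x $ j)))
      = - (\<Sum>j\<in>UNIV. M $ i $ j * ((if j = i then r else x $ j) - r))"
    by (simp add: sum_negf[symmetric] algebra_simps)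
  moreover have "r powr (p + 1) = r * r powr p" using assms by (simp add: powr_add)
  ultimately show ?thesis by (simp add: field_nth algebra_simps)
qed

lemma nash_equilibrium_iff:
  "nash_equilibrium (player_cost p (u, M, \<sigma>)) {0<..} x \<longleftrightarrow> x \<in> pos_orthant \<and> f x = 0"
proof
  assume N: "nash_equilibrium (player_cost p (u, M, \<sigma>)) {0<..} x"
  have x_pos: "0 < x $ i" for i using N by (simp add: nash_equilibrium_def)
  have "f x $ i = 0" for i
  proof -
    have self: "(\<chi> k. if k = i then x $ i else x $ k) = x" by (simp add: vec_eq_iff)
    have "- f (\<chi> k. if k = i then x $ i else x $ k) $ i = 0"
    \<comment> \<open>The radius \<open>x $ i\<close> keeps all competing strategies positive; the
      minimum is interior because the strategy set is open.\<close>
    proof (rule DERIV_local_min[OF player_cost_has_derivative[OF x_pos] x_pos[of i]], safe)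
      fix r assume "\<bar>x $ i - r\<bar> < x $ i"
      then have "0 < r" by linarith
      then show "player_cost p (u, M, \<sigma>) i (\<chi> k. if k = i then x $ i else x $ k)
          \<le> player_cost p (u, M, \<sigma>) i (\<chi> k. if k = i then r else x $ k)"
        using N unfolding self by (simp add: nash_equilibrium_def)
    qed
    then show ?thesis by (simp add: self)
  qed
  then show "x \<in> pos_orthant \<and> f x = 0" using x_pos by (simp add: pos_orthant_def vec_eq_iff)
next
  assume x: "x \<in> pos_orthant \<and> f x = 0"
  then have x_pos: "0 < x $ i" and f0: "f x $ i = 0" for i by (auto simp: pos_orthant_def)
  have "player_cost p (u, M, \<sigma>) i x \<le> player_cost p (u, M, \<sigma>) i (\<chi> k. if k = i then r else x $ k)"
    if r: "0 < r" for i r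
  proof -
    define y where "y s = (\<chi> k. if k = i then s else x $ k)" for s
    let ?c = "\<lambda>s. player_cost p (u, M, \<sigma>) i (y s)"
    have der: "(?c has_real_derivative - f (y s) $ i) (at s)" if "0 < s" for s
      unfolding y_def using that by (rule player_cost_has_derivative)
    text \<open>The derivative of the cost changes sign only at \<open>x\<^sub>i\<close>, although the cost is not convex.\<close>
    have sign: "x $ i * f (y s) $ i =
        (\<Sum>j\<in>UNIV - {i}. M $ i $ j * x $ j) * (x $ i - s) + \<sigma> $ i * x $ i * s * (x $ i powr p - s powr p)" for s
    proof -
      \<comment> \<open>Subtracting the vanishing term eliminates \<open>u $ i\<close> and leaves
        only differences between \<open>x $ i\<close> and \<open>s\<close>, all of the same
        sign.\<close>
      have "x $ i * f (y s) $ i = x $ i * f (y s) $ i - s * f x $ i" by (simp add: f0)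
      also have "\<dots> = (\<Sum>j\<in>UNIV. x $ i * (M $ i $ j * (y s $ j - s)) - s * (M $ i $ j * (x $ j - x $ i)))
          + \<sigma> $ i * x $ i * s * (x $ i powr p - s powr p)"
        by (simp add: field_nth sum_subtractf sum_distrib_left y_def algebra_simps)
      also have "(\<Sum>j\<in>UNIV. x $ i * (M $ i $ j * (y s $ j - s)) - s * (M $ i $ j * (x $ j - x $ i)))
          = (\<Sum>j\<in>UNIV - {i}. M $ i $ j * x $ j * (x $ i - s))"
        by (rule sum.mono_neutral_cong_right) (auto simp: y_def algebra_simps)
      finally show ?thesis by (simp add: sum_distrib_right)
    qed
    have nonneg: "0 \<le> (\<Sum>j\<in>UNIV - {i}. M $ i $ j * x $ j)"
      by (intro sum_nonneg mult_nonneg_nonneg M_nonneg less_imp_le[OF x_pos])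
    have "?c (x $ i) \<le> ?c r"
    proof (cases "r \<le> x $ i")
      case True
      have "0 \<le> f (y s) $ i" if "0 < s" "s \<le> x $ i" for s
      proof -
        have "0 \<le> x $ i * f (y s) $ i"
          unfolding sign using that p_pos x_pos[of i]
          by (intro add_nonneg_nonneg mult_nonneg_nonneg nonneg sigma_nonneg) (auto intro: powr_mono2)
        then show ?thesis using x_pos[of i] by (simp add: zero_le_mult_iff)
      qed
      then have "\<exists>d. (?c has_real_derivative d) (at s) \<and> d \<le> 0" if "r \<le> s" "s \<le> x $ i" for s
        using that r by (intro exI[of _ "- f (y s) $ i"] conjI der) auto
      then show ?thesis by (rule DERIV_nonpos_imp_nonincreasing[OF True])
    next
      case False
      have "f (y s) $ i \<le> 0" if "x $ i \<le> s" for s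
      proof -
        have "x $ i * f (y s) $ i \<le> 0"
          unfolding sign using that p_pos x_pos[of i]
          by (intro add_nonpos_nonpos mult_nonneg_nonpos mult_nonneg_nonneg nonneg sigma_nonneg)
            (auto intro: powr_mono2)
        then show ?thesis using x_pos[of i] by (simp add: mult_le_0_iff)
      qed
      then have "\<exists>d. (?c has_real_derivative d) (at s) \<and> 0 \<le> d" if "x $ i \<le> s" "s \<le> r" for s
        using that less_le_trans[OF x_pos that(1)] by (intro exI[of _ "- f (y s) $ i"] conjI der) auto
      then show ?thesis using False by (rule DERIV_nonneg_imp_nondecreasing[OF less_imp_le[OF not_le_imp_less], rotated])
    qed
    moreover have "y (x $ i) = x" by (simp add: y_def vec_eq_iff)
    ultimately show ?thesis by (simp add: y_def)
  qed
  then show "nash_equilibrium (player_cost p (u, M, \<sigma>)) {0<..} x"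
    using x_pos by (simp add: nash_equilibrium_def)
qed

text \<open>Along a kernel vector the field would be of smaller order than the displacement, whereas
  strict dissipation and Cauchy-Schwarz force it to be at least \<open>c\<close> times the
  displacement.\<close>

lemma jacobian_nonsingular: "det (opinion_jacobian p (u, M, \<sigma>) equilibrium) \<noteq> 0"
proof -
  let ?J = "opinion_jacobian p (u, M, \<sigma>) equilibrium"
  obtain \<delta> where \<delta>: "0 < \<delta>" "cball equilibrium \<delta> \<subseteq> pos_orthant"
    "\<And>x i. x \<in> cball equilibrium \<delta> \<Longrightarrow> (1 / 2) * equilibrium $ i \<le> x $ i"
    using equilibrium_neighbourhood by blast
  obtain c where c: "0 < c" "\<And>x. x \<in> pos_orthant \<Longrightarrow> (\<And>i. (1 / 2) * equilibrium $ i \<le> x $ i) \<Longrightarrow>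
      (x - equilibrium) \<bullet> f x \<le> - c * (norm (x - equilibrium))\<^sup>2"
    using strict_dissipation[OF steady_state, of "1 / 2"] by auto
  have "\<forall>e>0. \<exists>d>0. \<forall>y. norm (y - equilibrium) < d \<longrightarrow>
      norm (f y - f equilibrium - ?J *v (y - equilibrium)) \<le> e * norm (y - equilibrium)"
    using has_derivative_opinion_field_state[OF steady_state(1), of p "(u, M, \<sigma>)"]
    unfolding has_derivative_at_alt by blast
  \<comment> \<open>Any tolerance below \<open>c\<close> would yield the contradiction.\<close>
  from this[rule_format, of "c / 2"] c(1) obtain d where d: "0 < d" "\<And>y. norm (y - equilibrium) < d \<Longrightarrow>
      norm (f y - ?J *v (y - equilibrium)) \<le> c / 2 * norm (y - equilibrium)"
    by (auto simp: steady_state(2))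
  have "v = 0" if v: "?J *v v = 0" for v
  proof (rule ccontr)
    assume "v \<noteq> 0"
    define t where "t = min \<delta> (d / 2) / norm v"
    define y where "y = equilibrium + t *\<^sub>R v"
    have "norm (y - equilibrium) = min \<delta> (d / 2)"
      using \<open>v \<noteq> 0\<close> \<delta>(1) d(1) by (simp add: y_def t_def)
    then have ny: "norm (y - equilibrium) \<le> \<delta>" "norm (y - equilibrium) < d" "0 < norm (y - equilibrium)"
      using \<delta>(1) d(1) by auto
    have "?J *v (y - equilibrium) = t *\<^sub>R (?J *v v)" by (simp add: y_def matrix_vector_mult_scaleR)
    then have small: "norm (f y) \<le> c / 2 * norm (y - equilibrium)" using d(2)[OF ny(2)] v by simp
    have y: "y \<in> cball equilibrium \<delta>" using ny(1) by (simp add: dist_norm norm_minus_commute)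
    have "c * (norm (y - equilibrium))\<^sup>2 \<le> - ((y - equilibrium) \<bullet> f y)"
      using c(2)[of y] y \<delta>(2,3) by auto
    also have "\<dots> \<le> norm (y - equilibrium) * norm (f y)"
      using Cauchy_Schwarz_ineq2[of "y - equilibrium" "f y"] by linarith
    also have "\<dots> \<le> norm (y - equilibrium) * (c / 2 * norm (y - equilibrium))"
      using small by (intro mult_left_mono) auto
    also have "\<dots> = c / 2 * (norm (y - equilibrium))\<^sup>2" by (simp add: power2_eq_square)
    finally show False using c(1) ny(3) by (simp add: mult_le_cancel_right)
  qed
  then have "\<exists>B. B ** ?J = mat 1" by (simp add: matrix_left_invertible_ker)
  then show ?thesis
    by (meson invertible_det_nz invertible_left_inverse)
qed

end

section \<open>Smooth dependence on the parameters\<close>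

text \<open>The bootstrap gains an order because these coefficients involve the branch itself but
  none of its derivatives.\<close>

lemma Ck_on_opinion_entries:
  fixes g :: "'n::finite opinion_params \<Rightarrow> real^'n"
  assumes U: "open U" and g: "Ck_on k U g" and pos: "\<And>\<theta>. \<theta> \<in> U \<Longrightarrow> g \<theta> \<in> pos_orthant"
  shows "Ck_on k U (\<lambda>\<theta>. opinion_jacobian p \<theta> (g \<theta>) $ i $ j)"
    and "Ck_on k U (\<lambda>\<theta>. opinion_param_derivative p \<theta> (g \<theta>) v $ i)"
proof -
  have lin: "Ck_on k U (\<lambda>\<theta> :: 'n opinion_params. fst \<theta> $ i)"
    "Ck_on k U (\<lambda>\<theta> :: 'n opinion_params. fst (snd \<theta>) $ i $ j)"
    "Ck_on k U (\<lambda>\<theta> :: 'n opinion_params. snd (snd \<theta>) $ i)" for i j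
    using bounded_linear_compose[OF bounded_linear_vec_nth bounded_linear_fst]
      bounded_linear_compose[OF bounded_linear_vec_nth
        bounded_linear_compose[OF bounded_linear_vec_nth bounded_linear_compose[OF bounded_linear_fst bounded_linear_snd]]]
      bounded_linear_compose[OF bounded_linear_vec_nth bounded_linear_compose[OF bounded_linear_snd bounded_linear_snd]]
    by (blast intro: Ck_on_bounded_linear[OF U])+
  have comp: "Ck_on k U (\<lambda>\<theta>. g \<theta> $ i)" for i by (rule Ck_on_vec_nth[OF U g])
  have powr: "Ck_on k U (\<lambda>\<theta>. g \<theta> $ i powr p)" for i
    using pos by (intro Ck_on_powr[OF U _ comp]) (auto simp: pos_orthant_def)
  note intros = Ck_on_add Ck_on_diff Ck_on_mult Ck_on_sum U Ck_on_const lin comp powr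
  show "Ck_on k U (\<lambda>\<theta>. opinion_jacobian p \<theta> (g \<theta>) $ i $ j)"
    by (cases "i = j") (simp_all add: opinion_jacobian_def, (intro intros)+)
  show "Ck_on k U (\<lambda>\<theta>. opinion_param_derivative p \<theta> (g \<theta>) v $ i)"
    unfolding opinion_param_derivative_def vec_lambda_beta by (intro intros)
qed

lemma opinion_zero_branch_smooth:
  fixes g :: "'n::finite opinion_params \<Rightarrow> real^'n"
  assumes U: "open U" and diff: "\<And>\<theta>. \<theta> \<in> U \<Longrightarrow> g differentiable (at \<theta>)"
    and pos: "\<And>\<theta>. \<theta> \<in> U \<Longrightarrow> g \<theta> \<in> pos_orthant"
    and zero: "\<And>\<theta>. \<theta> \<in> U \<Longrightarrow> opinion_field p \<theta> (g \<theta>) = 0"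
    and nonsing: "\<And>\<theta>. \<theta> \<in> U \<Longrightarrow> det (opinion_jacobian p \<theta> (g \<theta>)) \<noteq> 0"
  shows "Ck_on k U g"
proof (induction k)
  case 0
  show ?case
    using diff by (auto intro!: differentiable_imp_continuous_on simp: differentiable_on_def differentiable_at_withinI)
next
  case (Suc k)
  have der: "(g has_derivative frechet_derivative g (at \<theta>)) (at \<theta>)" if "\<theta> \<in> U" for \<theta>
    using diff[OF that] by (simp add: frechet_derivative_works)
  have eq: "opinion_jacobian p \<theta> (g \<theta>) *v frechet_derivative g (at \<theta>) v
      = - 1 *\<^sub>R opinion_param_derivative p \<theta> (g \<theta>) v" if \<theta>: "\<theta> \<in> U" for \<theta> v
  proof -
    have "((\<lambda>\<theta>. (\<theta>, g \<theta>)) has_derivative (\<lambda>v. (v, frechet_derivative g (at \<theta>) v))) (at \<theta>)"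
      by (intro has_derivative_Pair has_derivative_ident der \<theta>)
    from has_derivative_compose[OF this has_derivative_opinion_field[OF pos[OF \<theta>]]]
    have "((\<lambda>\<theta>. opinion_field p \<theta> (g \<theta>)) has_derivative (\<lambda>v. opinion_param_derivative p \<theta> (g \<theta>) v
        + opinion_jacobian p \<theta> (g \<theta>) *v frechet_derivative g (at \<theta>) v)) (at \<theta>)"
      by simp
    \<comment> \<open>The composite vanishes on an open set; comparing with the chain rule gives the
      linear equation for the derivative of \<open>g\<close>.\<close>
    moreover have "((\<lambda>\<theta>. opinion_field p \<theta> (g \<theta>)) has_derivative (\<lambda>v. 0)) (at \<theta>)"
      by (rule has_derivative_transform_within_open[OF has_derivative_const U \<theta>]) (simp add: zero)
    ultimately have "(\<lambda>v. opinion_param_derivative p \<theta> (g \<theta>) v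
        + opinion_jacobian p \<theta> (g \<theta>) *v frechet_derivative g (at \<theta>) v) = (\<lambda>v. 0)"
      by (rule has_derivative_unique)
    from fun_cong[OF this, of v] show ?thesis by (simp add: add_eq_0_iff)
  qed
  have "Ck_on k U (\<lambda>\<theta>. frechet_derivative g (at \<theta>) v)" for v
  proof (rule Ck_on_linear_solve[OF U _ _ nonsing eq])
    show "Ck_on k U (\<lambda>\<theta>. (- 1 *\<^sub>R opinion_param_derivative p \<theta> (g \<theta>) v) $ i)" for i
      unfolding vector_scaleR_component real_scaleR_def
      by (intro Ck_on_mult U Ck_on_const Ck_on_opinion_entries Suc.IH pos)
  qed (use U Suc.IH pos in \<open>auto intro: Ck_on_opinion_entries(1)\<close>)
  then show ?case using Ck_on_SucI[OF U der] by blast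
qed

text \<open>The inverse function theorem is applied to \<open>(\<theta>, x) \<mapsto> (\<theta>, f\<^sub>\<theta> x)\<close>.\<close>
lemma opinion_zero_branch_exists:
  fixes \<theta>0 :: "'n::finite opinion_params"
  assumes x0: "x0 \<in> pos_orthant" "opinion_field p \<theta>0 x0 = 0" and det0: "det (opinion_jacobian p \<theta>0 x0) \<noteq> 0"
  obtains U g where "open U" "\<theta>0 \<in> U" "\<And>\<theta>. \<theta> \<in> U \<Longrightarrow> g differentiable (at \<theta>)"
    "\<And>\<theta>. \<theta> \<in> U \<Longrightarrow> g \<theta> \<in> pos_orthant" "\<And>\<theta>. \<theta> \<in> U \<Longrightarrow> opinion_field p \<theta> (g \<theta>) = 0"
    "\<And>\<theta>. \<theta> \<in> U \<Longrightarrow> det (opinion_jacobian p \<theta> (g \<theta>)) \<noteq> 0"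
proof -
  define S :: "('n opinion_params \<times> (real^'n)) set" where
    "S = {q \<in> UNIV \<times> pos_orthant. opinion_jacobian p (fst q) (snd q) \<in> {A. det A \<noteq> 0}}"
  define G where "G q = (fst q, opinion_field p (fst q) (snd q))" for q :: "'n opinion_params \<times> (real^'n)"
  define G' where "G' q v = (fst v, opinion_param_derivative p (fst q) (snd q) (fst v)
    + opinion_jacobian p (fst q) (snd q) *v snd v)" for q v :: "'n opinion_params \<times> (real^'n)"
  have pos_eq: "pos_orthant = (\<Inter>i. {x :: real^'n. 0 < x $ i})" by (auto simp: pos_orthant_def)
  have open_pos: "open (pos_orthant :: (real^'n) set)"
    unfolding pos_eq by (intro open_INT ballI open_Collect_less continuous_intros) auto
  have "continuous_on UNIV (det :: real^'n^'n \<Rightarrow> real)"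
    unfolding det_def[abs_def] by (intro continuous_intros)
  then have open_det: "open {A :: real^'n^'n. det A \<noteq> 0}"
    by (rule open_Collect_neq) (rule continuous_on_const)
  have "open S"
    using continuous_open_preimage[OF continuous_on_opinion_jacobian open_Times[OF open_UNIV open_pos] open_det, of p]
    by (simp only: S_def vimage_def Int_def mem_Collect_eq)
  have der: "(G has_derivative G' q) (at q)" if "q \<in> S" for q
  proof -
    have "((\<lambda>q. opinion_field p (fst q) (snd q)) has_derivative
        (\<lambda>v. opinion_param_derivative p (fst q) (snd q) (fst v)
          + opinion_jacobian p (fst q) (snd q) *v snd v)) (at q)"
      using has_derivative_opinion_field[of "snd q" p "fst q"] that by (auto simp: S_def)
    then show ?thesis
      unfolding G_def G'_def by (intro has_derivative_Pair has_derivative_fst has_derivative_ident)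
  qed
  have lin: "bounded_linear (G' q)" if "q \<in> S" for q using der[OF that] by (rule has_derivative_bounded_linear)
  have blinfun_der: "(G has_derivative blinfun_apply (Blinfun (G' q))) (at q)" if "q \<in> S" for q
    using der[OF that] by (simp add: bounded_linear_Blinfun_apply lin[OF that])
  have cont: "continuous_on S (\<lambda>q. Blinfun (G' q))"
  proof (rule continuous_on_blinfun_componentwise)
    fix b :: "'n opinion_params \<times> (real^'n)"
    have "continuous_on S (\<lambda>q. opinion_jacobian p (fst q) (snd q))"
      by (rule continuous_on_subset[OF continuous_on_opinion_jacobian]) (auto simp: S_def)
    then have "continuous_on S (\<lambda>q. opinion_jacobian p (fst q) (snd q) *v snd b)"
      unfolding matrix_vector_mult_def by (intro continuous_intros)
    moreover have "continuous_on S (\<lambda>q. opinion_param_derivative p (fst q) (snd q) (fst b))"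
      unfolding opinion_param_derivative_def
      by (intro continuous_intros) (auto simp: S_def pos_orthant_def, metis less_irrefl)
    ultimately have "continuous_on S (\<lambda>q. G' q b)"
      unfolding G'_def by (intro continuous_intros)
    then show "continuous_on S (\<lambda>q. blinfun_apply (Blinfun (G' q)) b)"
      by (rule continuous_on_eq) (simp add: bounded_linear_Blinfun_apply lin)
  qed
  have q0: "(\<theta>0, x0) \<in> S" using x0(1) det0 by (simp add: S_def)
  \<comment> \<open>The derivative is block triangular, with the identity in the parameters and the
    Jacobian in the state.\<close>
  have "inj (G' (\<theta>0, x0))"
  proof (rule iffD2[OF linear_injective_0[OF bounded_linear.linear[OF lin[OF q0]]]], safe)
    fix a b assume "G' (\<theta>0, x0) (a, b) = 0"
    then have "a = 0" "opinion_jacobian p \<theta>0 x0 *v b = 0"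
      by (auto simp: G'_def opinion_param_derivative_def zero_prod_def zero_vec_def[symmetric])
    moreover have "\<exists>B. B ** opinion_jacobian p \<theta>0 x0 = mat 1"
      using det0 invertible_det_nz invertible_left_inverse by blast
    ultimately show "(a, b) = 0" by (simp add: matrix_left_invertible_ker zero_prod_def)
  qed
  then obtain l where l: "linear l" "l \<circ> G' (\<theta>0, x0) = id"
    using linear_injective_left_inverse bounded_linear.linear[OF lin[OF q0]] by blast
  have inv: "Blinfun l o\<^sub>L Blinfun (G' (\<theta>0, x0)) = id_blinfun"
    using l(2) iffD1[OF linear_conv_bounded_linear l(1)] lin[OF q0]
    by (intro blinfun_eqI) (simp add: bounded_linear_Blinfun_apply pointfree_idE)
  obtain S' V h h' where V: "S' \<subseteq> S" "open V" "G (\<theta>0, x0) \<in> V" "homeomorphism S' V G h"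
    and derh: "\<And>y. y \<in> V \<Longrightarrow> (h has_derivative h' y) (at y)"
    by (rule inverse_function_theorem[OF \<open>open S\<close> blinfun_der cont q0 inv]) (assumption, rule that)
  \<comment> \<open>The branch is the local inverse restricted to the slice where the field takes
    the value zero.\<close>
  define U where "U = (\<lambda>\<theta>. (\<theta>, 0)) -` V"
  have hU: "fst (h (\<theta>, 0)) = \<theta>" "opinion_field p \<theta> (snd (h (\<theta>, 0))) = 0" "(\<theta>, snd (h (\<theta>, 0))) \<in> S"
    if "\<theta> \<in> U" for \<theta>
  proof -
    have "(\<theta>, 0) \<in> V" using that by (simp add: U_def)
    then have "G (h (\<theta>, 0)) = (\<theta>, 0)" "h (\<theta>, 0) \<in> S"
      using V(1,4) by (auto simp: homeomorphism_def)
    then show "fst (h (\<theta>, 0)) = \<theta>" "opinion_field p \<theta> (snd (h (\<theta>, 0))) = 0" "(\<theta>, snd (h (\<theta>, 0))) \<in> S"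
      using prod.collapse[of "h (\<theta>, 0)"] by (auto simp: G_def)
  qed
  show thesis
  proof (rule that[of U "\<lambda>\<theta>. snd (h (\<theta>, 0))"])
    show "open U" unfolding U_def by (rule open_vimage[OF V(2)]) (intro continuous_intros)
    show "\<theta>0 \<in> U" using V(3) x0(2) by (simp add: U_def G_def)
    fix \<theta> assume \<theta>: "\<theta> \<in> U"
    have "((\<lambda>\<theta>. (\<theta>, 0)) has_derivative (\<lambda>v. (v, 0))) (at \<theta>)"
      by (auto intro!: derivative_eq_intros)
    from has_derivative_snd[OF has_derivative_compose[OF this derh]] \<theta>
    show "(\<lambda>\<theta>. snd (h (\<theta>, 0))) differentiable (at \<theta>)"
      unfolding differentiable_def U_def vimage_eq by blast
    show "snd (h (\<theta>, 0)) \<in> pos_orthant" "det (opinion_jacobian p \<theta> (snd (h (\<theta>, 0)))) \<noteq> 0"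
      using hU(3)[OF \<theta>] by (auto simp: S_def)
    show "opinion_field p \<theta> (snd (h (\<theta>, 0))) = 0" by (rule hU(2)[OF \<theta>])
  qed
qed

lemma steady_state_smooth:
  assumes "0 < p"
  shows "smooth_on {\<theta> :: 'n::finite opinion_params. \<theta> \<in> model_params \<and> anchored \<theta>} (steady_state p)"
  unfolding smooth_on_def
proof
  fix \<theta>0 :: "'n opinion_params" assume "\<theta>0 \<in> {\<theta>. \<theta> \<in> model_params \<and> anchored \<theta>}"
  then obtain u0 M0 \<sigma>0 where \<theta>0: "\<theta>0 = (u0, M0, \<sigma>0)" and "opinion_model p u0 M0 \<sigma>0"
    using assms by (cases \<theta>0) (auto simp: opinion_model_def)
  interpret m: opinion_model p u0 M0 \<sigma>0 by fact
  obtain U g where U: "open U" "\<theta>0 \<in> U"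
    and g: "\<And>\<theta>. \<theta> \<in> U \<Longrightarrow> g differentiable (at \<theta>)" "\<And>\<theta>. \<theta> \<in> U \<Longrightarrow> g \<theta> \<in> pos_orthant"
      "\<And>\<theta>. \<theta> \<in> U \<Longrightarrow> opinion_field p \<theta> (g \<theta>) = 0"
      "\<And>\<theta>. \<theta> \<in> U \<Longrightarrow> det (opinion_jacobian p \<theta> (g \<theta>)) \<noteq> 0"
    unfolding \<theta>0
    by (rule opinion_zero_branch_exists[OF m.steady_state m.jacobian_nonsingular]) blast
  \<comment> \<open>Both are zeros of the field in the positive orthant, so global uniqueness makes
    them equal, with no smallness condition on the branch.\<close>
  have "g \<theta> = steady_state p \<theta>" if "\<theta> \<in> {\<theta>. \<theta> \<in> model_params \<and> anchored \<theta>} \<inter> U" for \<theta>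
  proof -
    obtain u M \<sigma> where \<theta>: "\<theta> = (u, M, \<sigma>)" by (cases \<theta>)
    interpret opinion_model p u M \<sigma> using assms that by unfold_locales (auto simp: \<theta>)
    show ?thesis using that g(2,3)[of \<theta>] steady_state_unique[OF steady_state] by (simp add: \<theta>)
  qed
  then show "\<exists>U g. open U \<and> \<theta>0 \<in> U \<and> (\<forall>k. Ck_on k U g) \<and>
      (\<forall>\<theta>\<in>{\<theta>. \<theta> \<in> model_params \<and> anchored \<theta>} \<inter> U. g \<theta> = steady_state p \<theta>)"
    using U opinion_zero_branch_smooth[OF U(1) g] by blast
qed

theorem theorem1p2:
  fixes p :: real
  assumes "p > 0"
  shows "(\<forall>(u :: real^'n) (M :: real^'n^'n) (\<sigma> :: real^'n).
      (u, M, \<sigma>) \<in> model_params \<longrightarrow> anchored (u, M, \<sigma>) \<longrightarrow>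
      (\<exists>!x. x \<in> pos_orthant \<and>
         (\<forall>i. (\<Sum>j\<in>UNIV. M $ i $ j * (x $ j - x $ i))
               + \<sigma> $ i * (u $ i - x $ i powr p) * x $ i = 0)) \<and>
      locally_exponentially_stable (opinion_field p (u, M, \<sigma>)) pos_orthant
        (steady_state p (u, M, \<sigma>)) \<and>
      (\<exists>!z. nash_equilibrium (player_cost p (u, M, \<sigma>)) {0<..} z) \<and>
      nash_equilibrium (player_cost p (u, M, \<sigma>)) {0<..} (steady_state p (u, M, \<sigma>)) \<and>
      (\<forall>x. solves_ode_on (opinion_field p (u, M, \<sigma>)) pos_orthant {0..} x \<longrightarrow>
         (x \<longlongrightarrow> steady_state p (u, M, \<sigma>)) at_top)) \<and>
    smooth_on {\<theta> :: 'n::finite opinion_params. \<theta> \<in> model_params \<and> anchored \<theta>} (steady_state p)"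
proof (intro conjI allI impI steady_state_smooth assms)
  fix u :: "real^'n" and M :: "real^'n^'n" and \<sigma> :: "real^'n"
  assume "(u, M, \<sigma>) \<in> model_params" "anchored (u, M, \<sigma>)"
  then interpret opinion_model p u M \<sigma> using assms by unfold_locales
  show "\<exists>!x. x \<in> pos_orthant \<and>
      (\<forall>i. (\<Sum>j\<in>UNIV. M $ i $ j * (x $ j - x $ i)) + \<sigma> $ i * (u $ i - x $ i powr p) * x $ i = 0)"
    using ex1_steady_state by (simp add: vec_eq_iff field_nth)
  show "locally_exponentially_stable f pos_orthant equilibrium" by (rule exponentially_stable)
  show "\<exists>!z. nash_equilibrium (player_cost p (u, M, \<sigma>)) {0<..} z"
    unfolding nash_equilibrium_iff by (rule ex1_steady_state)
  show "nash_equilibrium (player_cost p (u, M, \<sigma>)) {0<..} equilibrium"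
    unfolding nash_equilibrium_iff using steady_state by blast
  show "(x \<longlongrightarrow> equilibrium) at_top" if "solves_ode_on f pos_orthant {0..} x" for x
    using that by (rule solution_converges)
qed

end
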